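(* Let $n$ be a positive integer, let $\Omega_q\subseteq\mathbb{H}$ be an axially symmetric connected open set with $\Omega_q\cap\mathbb{R}=\emptyset$, and let $T_1,T_2\in B_n^{s}(\Omega_q)$. Then $T_1$ and $T_2$ are quaternion unitarily equivalent if and only if $E_{T_1}$ and $E_{T_2}$ are equivalent as Hermitian right holomorphic quaternionic vector bundles.
   Context: $\mathbb{H}$ denotes the quaternions with units $\boldsymbol{i},\boldsymbol{j},\boldsymbol{k}$; $\mathbb{C}$ is identified with $\{a+b\boldsymbol{i}\}\subset\mathbb{H}$. For $p,q\in\mathbb{H}$, $p\sim q$ means $|p|=|q|$ and $\mathrm{Re}(p)=\mathrm{Re}(q)$; a subset of $\mathbb{H}$ is axially symmetric if it contains, with each $x$, all $y\sim x$. For $\omega\in\mathbb{H}$ put $\omega_{red}=\mathrm{Re}(\omega)+\boldsymbol{i}|\mathrm{Im}(\omega)|$ and $\Omega_{red}=\{\omega_{red}:\omega\in\Omega_q\}\subset\mathbb{C}$. $\mathcal{H}_q$ is a separable quaternionic Hilbert space (right $\mathbb{H}$-vector space, inner product $\langle\cdot,\cdot\rangle_{\mathbb{H}}$ with $\langle x,y\rangle_{\mathbb H}=\overline{\langle y,x\rangle_{\mathbb H}}$ and $\langle xp+yq,z\rangle_{\mathbb H}=\langle x,z\rangle_{\mathbb H}p+\langle y,z\rangle_{\mathbb H}q$). $L_r(\mathcal{H}_q)$ is the set of bounded right $\mathbb{H}$-linear operators on $\mathcal{H}_q$. $\bigvee_{\mathbb{H}}$ denotes closed right $\mathbb{H}$-linear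 span. The $S$-spectrum is $\sigma_s(T)=\{s\in\mathbb{H}: T^2-2\mathrm{Re}(s)T+|s|^2\boldsymbol{I}\text{ is not invertible}\}$. $B_n^s(\Omega_q)$ is the set of $T\in L_r(\mathcal{H}_q)$ with: (a) $\Omega_q\subseteq\sigma_s(T)$; (b) $\mathrm{ran}(T^2-2\mathrm{Re}(\omega)T+|\omega|^2)=\mathcal{H}_q$ for all $\omega\in\Omega_q$; (c) $\bigvee_{\mathbb{H}}\{\ker(T^2-2\mathrm{Re}(\omega)T+|\omega|^2):\omega\in\Omega_q\}=\mathcal{H}_q$; (d) $\dim_{\mathbb{H}}\ker(T^2-2\mathrm{Re}(\omega)T+|\omega|^2)=n$ for all $\omega\in\Omega_q$. For $T\in B_n^s(\Omega_q)$ let $t_T(\omega)=\ker(T^2-2\mathrm{Re}(\omega)T+|\omega|^2)$ for $\omega\in\Omega_{red}$, and let $E_T=\{(x,\omega):x\in t_T(\omega),\ \omega\in\Omega_{red}\}$ with projection $\pi(x,\omega)=\omega$; this is an $n$-dimensional Hermitian right holomorphic quaternionic vector bundle over $\Omega_{red}$. A map $\gamma$ from an open set of $\mathbb{C}$ to $\mathcal{H}_q$ is right holomorphic if $\gamma'(z)=\lim_{h\to0}(\gamma(z+h)-\gamma(z))h^{-1}$ exists ($h\in\mathbb{C}\setminus\{0\}$) at every point; $\gamma^{(m)}$ is the $m$-th derivative. A right holomorphic cross-section of $E_T$ over an open set $\Delta\subseteq\Omega_{red}$ is a right holomorphic $\gamma:\Delta\to\mathcal{H}_q$ with $\gamma(\omega)\in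 t_T(\omega)$ for all $\omega\in\Delta$. $E_{T_1}$ and $E_{T_2}$ are equivalent as Hermitian right holomorphic quaternionic vector bundles if there is a (fibre-preserving) bundle map $\Phi:E_{T_1}\to E_{T_2}$ such that: (1) for any $\omega\in\Omega_{red}$, $\Phi$ restricts to a quaternionic right linear isomorphism $t_{T_1}(\omega)\to t_{T_2}(\omega)$; (2) for any right holomorphic cross-section $\gamma$ in $E_{T_1}$, $\Phi(\gamma)$ is a right holomorphic cross-section in $E_{T_2}$; (3) for any right holomorphic cross-sections $\gamma,\widetilde\gamma$ in $E_{T_1}$ (over the same open set) and all integers $m\ge0$, $\langle\gamma^{(m)},\widetilde\gamma\rangle_{\mathbb{H}}=\langle(\Phi(\gamma))^{(m)},\Phi(\widetilde\gamma)\rangle_{\mathbb{H}}$. $T_1,T_2$ are quaternion unitarily equivalent if there is $U\in L_r(\mathcal{H}_q)$ with $U^*U=UU^*=\boldsymbol{I}$ and $UT_1=T_2U$. *)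

theory Defs
  imports "HOL-Analysis.Analysis"
begin

section \<open>Quaternions\<close>

codatatype quat = Quat (qRe: real) (qI: real) (qJ: real) (qK: real)

lemma quat_eqI [intro?]:
  "qRe x = qRe y \<Longrightarrow> qI x = qI y \<Longrightarrow> qJ x = qJ y \<Longrightarrow> qK x = qK y \<Longrightarrow> x = y"
  by (rule quat.expand) simp

lemma quat_eq_iff: "x = y \<longleftrightarrow> qRe x = qRe y \<and> qI x = qI y \<and> qJ x = qJ y \<and> qK x = qK y"
  by (auto intro: quat.expand)

instantiation quat :: ab_group_add
begin

primcorec zero_quat where
  "qRe 0 = 0" | "qI 0 = 0" | "qJ 0 = 0" | "qK 0 = 0"

primcorec plus_quat where
  "qRe (x + y) = qRe x + qRe y"
| "qI (x + y) = qI x + qI y"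
| "qJ (x + y) = qJ x + qJ y"
| "qK (x + y) = qK x + qK y"

primcorec uminus_quat where
  "qRe (- x) = - qRe x" | "qI (- x) = - qI x" | "qJ (- x) = - qJ x" | "qK (- x) = - qK x"

primcorec minus_quat where
  "qRe (x - y) = qRe x - qRe y"
| "qI (x - y) = qI x - qI y"
| "qJ (x - y) = qJ x - qJ y"
| "qK (x - y) = qK x - qK y"

instance
  by standard (simp_all add: quat_eq_iff)

end

instantiation quat :: ring_1
begin

primcorec one_quat where
  "qRe 1 = 1" | "qI 1 = 0" | "qJ 1 = 0" | "qK 1 = 0"

primcorec times_quat where
  "qRe (x * y) = qRe x * qRe y - qI x * qI y - qJ x * qJ y - qK x * qK y"
| "qI (x * y) = qRe x * qI y + qI x * qRe y + qJ x * qK y - qK x * qJ y"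
| "qJ (x * y) = qRe x * qJ y - qI x * qK y + qJ x * qRe y + qK x * qI y"
| "qK (x * y) = qRe x * qK y + qI x * qJ y - qJ x * qI y + qK x * qRe y"

instance
  by standard (simp_all add: quat_eq_iff algebra_simps)

end

lemma quat_unit_products:
  defines "i \<equiv> Quat 0 1 0 0" and "j \<equiv> Quat 0 0 1 0" and "k \<equiv> Quat 0 0 0 1"
  shows "i * i = -1" "j * j = -1" "k * k = -1" "i * j = k" "j * k = i" "k * i = j"
  by (simp_all add: assms quat_eq_iff)

instantiation quat :: real_algebra_1
begin

primcorec scaleR_quat where
  "qRe (scaleR r x) = r * qRe x"
| "qI (scaleR r x) = r * qI x"
| "qJ (scaleR r x) = r * qJ x"
| "qK (scaleR r x) = r * qK x"

instance
  by standard (simp_all add: quat_eq_iff algebra_simps)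

end

lemma of_real_quat_simps [simp]:
  "qRe (of_real r) = r" "qI (of_real r) = 0" "qJ (of_real r) = 0" "qK (of_real r) = 0"
  by (simp_all add: of_real_def)

primcorec qcnj :: "quat \<Rightarrow> quat" where
  "qRe (qcnj x) = qRe x"
| "qI (qcnj x) = - qI x"
| "qJ (qcnj x) = - qJ x"
| "qK (qcnj x) = - qK x"

primcorec qIm :: "quat \<Rightarrow> quat" where
  "qRe (qIm x) = 0" | "qI (qIm x) = qI x" | "qJ (qIm x) = qJ x" | "qK (qIm x) = qK x"

primcorec quat_of_complex :: "complex \<Rightarrow> quat" where
  "qRe (quat_of_complex z) = Re z"
| "qI (quat_of_complex z) = Im z"
| "qJ (quat_of_complex z) = 0"
| "qK (quat_of_complex z) = 0"

instantiation quat :: real_inner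
begin

definition inner_quat :: "quat \<Rightarrow> quat \<Rightarrow> real" where
  "inner_quat x y = qRe x * qRe y + qI x * qI y + qJ x * qJ y + qK x * qK y"

definition norm_quat :: "quat \<Rightarrow> real" where
  "norm_quat x = sqrt (inner x x)"

definition sgn_quat :: "quat \<Rightarrow> quat" where
  "sgn_quat x = x /\<^sub>R norm x"

definition dist_quat :: "quat \<Rightarrow> quat \<Rightarrow> real" where
  "dist_quat x y = norm (x - y)"

definition uniformity_quat :: "(quat \<times> quat) filter" where
  "uniformity_quat = (INF e\<in>{0 <..}. principal {(x, y). dist x y < e})"

definition open_quat :: "quat set \<Rightarrow> bool" where
  "open_quat U \<longleftrightarrow> (\<forall>x\<in>U. \<forall>\<^sub>F (x', y) in uniformity. x' = x \<longrightarrow> y \<in> U)"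

instance
proof
  fix x y z :: quat and r :: real
  show "inner x x = 0 \<longleftrightarrow> x = 0"
    by (simp add: inner_quat_def quat_eq_iff add_nonneg_eq_0_iff)
qed (auto simp: inner_quat_def norm_quat_def sgn_quat_def dist_quat_def
      uniformity_quat_def open_quat_def algebra_simps)

end

lemma norm_quat_mult: "norm (x * y) = norm x * norm (y :: quat)"
proof -
  have "inner (x * y) (x * y) = inner x x * inner y y"
    by (simp add: inner_quat_def algebra_simps)
  then show ?thesis
    by (simp add: norm_quat_def real_sqrt_mult)
qed

instantiation quat :: division_ring
begin

definition inverse_quat :: "quat \<Rightarrow> quat" where
  "inverse_quat x = qcnj x /\<^sub>R (norm x)\<^sup>2"

definition divide_quat :: "quat \<Rightarrow> quat \<Rightarrow> quat" where
  "divide_quat x y = x * inverse y"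

instance
proof
  fix x y :: quat
  have c: "qcnj x * x = of_real ((norm x)\<^sup>2)" "x * qcnj x = of_real ((norm x)\<^sup>2)"
    by (simp_all only: power2_norm_eq_inner)
      (simp_all add: quat_eq_iff inner_quat_def algebra_simps)
  show "inverse x * x = 1" "x * inverse x = 1" if "x \<noteq> 0"
    using that c by (simp_all add: inverse_quat_def of_real_def)
  show "x div y = x * inverse y"
    by (simp add: divide_quat_def)
  show "inverse (0 :: quat) = 0"
    by (simp add: inverse_quat_def quat_eq_iff)
qed

end

instance quat :: real_normed_div_algebra
  by standard (rule norm_quat_mult)

definition qsim :: "quat \<Rightarrow> quat \<Rightarrow> bool" where
  "qsim p q \<longleftrightarrow> norm p = norm q \<and> qRe p = qRe q"

definition axially_symmetric :: "quat set \<Rightarrow> bool" where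
  "axially_symmetric \<Omega> \<longleftrightarrow> (\<forall>x\<in>\<Omega>. \<forall>y. qsim y x \<longrightarrow> y \<in> \<Omega>)"

definition qred :: "quat \<Rightarrow> complex" where
  "qred \<omega> = of_real (qRe \<omega>) + \<i> * of_real (norm (qIm \<omega>))"


section \<open>Quaternionic Hilbert spaces\<close>

text \<open>
  The real inner product of the superclass is the real part of the quaternionic one. As the
  quaternionic product is Hermitian, \<open>qinner x x\<close> is real, and so it equals \<open>inner x x\<close>;
  positive definiteness and the norm \<open>norm x = sqrt (inner x x)\<close> come from the superclass.
\<close>

class quat_inner = real_inner +
  fixes scaleQ :: "'a \<Rightarrow> quat \<Rightarrow> 'a"  (infixl "*\<^sub>Q" 75)
    and qinner :: "'a \<Rightarrow> 'a \<Rightarrow> quat"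
  assumes scaleQ_add_left: "(x + y) *\<^sub>Q p = x *\<^sub>Q p + y *\<^sub>Q p"
    and scaleQ_add_right: "x *\<^sub>Q (p + q) = x *\<^sub>Q p + x *\<^sub>Q q"
    and scaleQ_scaleQ: "x *\<^sub>Q p *\<^sub>Q q = x *\<^sub>Q (p * q)"
    and scaleQ_of_real: "x *\<^sub>Q of_real r = r *\<^sub>R x"
    and qinner_commute: "qinner x y = qcnj (qinner y x)"
    and qinner_linear: "qinner (x *\<^sub>Q p + y *\<^sub>Q q) z = qinner x z * p + qinner y z * q"
    and qRe_qinner: "qRe (qinner x y) = inner x y"

class separable_quat_hilbert = quat_inner + complete_space +
  assumes separable: "\<exists>D. countable D \<and> (\<forall>x. \<forall>e>0. \<exists>d\<in>D. dist d x < e)"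

definition qspan :: "'a::quat_inner set \<Rightarrow> 'a set" where
  "qspan S = {\<Sum>b\<in>B. b *\<^sub>Q c b | B c. finite B \<and> B \<subseteq> S}"

definition qindependent :: "'a::quat_inner set \<Rightarrow> bool" where
  "qindependent S \<longleftrightarrow>
     (\<forall>B c. finite B \<and> B \<subseteq> S \<and> (\<Sum>b\<in>B. b *\<^sub>Q c b) = 0 \<longrightarrow> (\<forall>b\<in>B. c b = 0))"

definition has_qdim :: "'a::quat_inner set \<Rightarrow> nat \<Rightarrow> bool" where
  "has_qdim V n \<longleftrightarrow> (\<exists>B. finite B \<and> card B = n \<and> qindependent B \<and> qspan B = V)"


section \<open>Right linear operators and the S-spectrum\<close>

definition L_r :: "('a::quat_inner \<Rightarrow> 'a) set" where
  "L_r = {T. bounded_linear T \<and> (\<forall>x q. T (x *\<^sub>Q q) = T x *\<^sub>Q q)}"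

definition L_r_invertible :: "('a::quat_inner \<Rightarrow> 'a) \<Rightarrow> bool" where
  "L_r_invertible T \<longleftrightarrow> (\<exists>S\<in>L_r. S \<circ> T = id \<and> T \<circ> S = id)"

definition S_op :: "('a::quat_inner \<Rightarrow> 'a) \<Rightarrow> quat \<Rightarrow> 'a \<Rightarrow> 'a" where
  "S_op T s = (\<lambda>x. T (T x) - (2 * qRe s) *\<^sub>R T x + (norm s)\<^sup>2 *\<^sub>R x)"

definition S_spectrum :: "('a::quat_inner \<Rightarrow> 'a) \<Rightarrow> quat set" where
  "S_spectrum T = {s. \<not> L_r_invertible (S_op T s)}"

definition op_ker :: "('a::quat_inner \<Rightarrow> 'a) \<Rightarrow> 'a set" where
  "op_ker A = {x. A x = 0}"

definition B_s :: "nat \<Rightarrow> quat set \<Rightarrow> ('a::separable_quat_hilbert \<Rightarrow> 'a) set" where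
  "B_s n \<Omega> = {T \<in> L_r.
     \<Omega> \<subseteq> S_spectrum T \<and>
     (\<forall>\<omega>\<in>\<Omega>. range (S_op T \<omega>) = UNIV) \<and>
     closure (qspan (\<Union>\<omega>\<in>\<Omega>. op_ker (S_op T \<omega>))) = UNIV \<and>
     (\<forall>\<omega>\<in>\<Omega>. has_qdim (op_ker (S_op T \<omega>)) n)}"

definition is_qadjoint :: "('a::quat_inner \<Rightarrow> 'a) \<Rightarrow> ('a \<Rightarrow> 'a) \<Rightarrow> bool" where
  "is_qadjoint U V \<longleftrightarrow> (\<forall>x y. qinner (U x) y = qinner x (V y))"

lemma is_qadjoint_unique:
  fixes U :: "'a::quat_inner \<Rightarrow> 'a"
  shows "is_qadjoint U V \<Longrightarrow> is_qadjoint U W \<Longrightarrow> V = W"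
  unfolding is_qadjoint_def
  by (metis (no_types, lifting) ext qRe_qinner vector_eq_rdot inner_commute)

text \<open>In the next definition, \<open>V\<close> is the (unique) adjoint of \<open>U\<close>.\<close>

definition q_unitarily_equivalent ::
    "('a::quat_inner \<Rightarrow> 'a) \<Rightarrow> ('a \<Rightarrow> 'a) \<Rightarrow> bool" where
  "q_unitarily_equivalent T1 T2 \<longleftrightarrow>
     (\<exists>U\<in>L_r. (\<exists>V\<in>L_r. is_qadjoint U V \<and> V \<circ> U = id \<and> U \<circ> V = id) \<and> U \<circ> T1 = T2 \<circ> U)"


section \<open>Right holomorphic maps and the bundle of an operator\<close>

definition right_quotient :: "(complex \<Rightarrow> 'a::quat_inner) \<Rightarrow> complex \<Rightarrow> complex \<Rightarrow> 'a" where
  "right_quotient \<gamma> z h = (\<gamma> (z + h) - \<gamma> z) *\<^sub>Q inverse (quat_of_complex h)"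

definition right_holomorphic_on :: "(complex \<Rightarrow> 'a::quat_inner) \<Rightarrow> complex set \<Rightarrow> bool" where
  "right_holomorphic_on \<gamma> \<Delta> \<longleftrightarrow> (\<forall>z\<in>\<Delta>. \<exists>D. (right_quotient \<gamma> z \<longlongrightarrow> D) (at 0))"

definition right_deriv :: "(complex \<Rightarrow> 'a::quat_inner) \<Rightarrow> complex \<Rightarrow> 'a" where
  "right_deriv \<gamma> z = Lim (at 0) (right_quotient \<gamma> z)"

definition fibre :: "('a \<times> complex) set \<Rightarrow> complex \<Rightarrow> 'a set" where
  "fibre E \<omega> = {x. (x, \<omega>) \<in> E}"

definition E_bundle :: "quat set \<Rightarrow> ('a::quat_inner \<Rightarrow> 'a) \<Rightarrow> ('a \<times> complex) set" where
  "E_bundle \<Omega> T = {(x, \<omega>). \<omega> \<in> qred ` \<Omega> \<and> x \<in> op_ker (S_op T (quat_of_complex \<omega>))}"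

text \<open>
  Sections are represented by total functions \<open>complex \<Rightarrow> 'a\<close> of which only the restriction to
  the open set \<open>\<Delta>\<close> matters; likewise bundle maps are total functions of which only the
  restriction to the total space matters.
\<close>

definition holomorphic_section ::
    "complex set \<Rightarrow> ('a::quat_inner \<times> complex) set \<Rightarrow> complex set \<Rightarrow> (complex \<Rightarrow> 'a) \<Rightarrow> bool" where
  "holomorphic_section base E \<Delta> \<gamma> \<longleftrightarrow>
     open \<Delta> \<and> \<Delta> \<subseteq> base \<and> right_holomorphic_on \<gamma> \<Delta> \<and> (\<forall>\<omega>\<in>\<Delta>. \<gamma> \<omega> \<in> fibre E \<omega>)"

definition bundle_map ::
    "('a::quat_inner \<times> complex) set \<Rightarrow> ('a \<times> complex) set \<Rightarrow>
     ('a \<times> complex \<Rightarrow> 'a \<times> complex) \<Rightarrow> bool" where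
  "bundle_map E1 E2 \<Phi> \<longleftrightarrow>
     continuous_on E1 \<Phi> \<and> \<Phi> ` E1 \<subseteq> E2 \<and> (\<forall>e\<in>E1. snd (\<Phi> e) = snd e)"

definition on_fibre :: "('a \<times> complex \<Rightarrow> 'a \<times> complex) \<Rightarrow> complex \<Rightarrow> 'a \<Rightarrow> 'a" where
  "on_fibre \<Phi> \<omega> x = fst (\<Phi> (x, \<omega>))"

definition on_section ::
    "('a \<times> complex \<Rightarrow> 'a \<times> complex) \<Rightarrow> (complex \<Rightarrow> 'a) \<Rightarrow> complex \<Rightarrow> 'a" where
  "on_section \<Phi> \<gamma> = (\<lambda>\<omega>. on_fibre \<Phi> \<omega> (\<gamma> \<omega>))"

definition right_linear_iso ::
    "'a::quat_inner set \<Rightarrow> 'a set \<Rightarrow> ('a \<Rightarrow> 'a) \<Rightarrow> bool" where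
  "right_linear_iso V W f \<longleftrightarrow>
     bij_betw f V W \<and>
     (\<forall>x\<in>V. \<forall>y\<in>V. f (x + y) = f x + f y) \<and>
     (\<forall>x\<in>V. \<forall>q. f (x *\<^sub>Q q) = f x *\<^sub>Q q)"

definition hermitian_bundles_equivalent ::
    "complex set \<Rightarrow> ('a::quat_inner \<times> complex) set \<Rightarrow> ('a \<times> complex) set \<Rightarrow> bool" where
  "hermitian_bundles_equivalent base E1 E2 \<longleftrightarrow>
     (\<exists>\<Phi>. bundle_map E1 E2 \<Phi> \<and>
       (\<forall>\<omega>\<in>base. right_linear_iso (fibre E1 \<omega>) (fibre E2 \<omega>) (on_fibre \<Phi> \<omega>)) \<and>
       (\<forall>\<Delta> \<gamma>. holomorphic_section base E1 \<Delta> \<gamma> \<longrightarrow>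
              holomorphic_section base E2 \<Delta> (on_section \<Phi> \<gamma>)) \<and>
       (\<forall>\<Delta> \<gamma> \<gamma>'. holomorphic_section base E1 \<Delta> \<gamma> \<and> holomorphic_section base E1 \<Delta> \<gamma>' \<longrightarrow>
          (\<forall>m. \<forall>\<omega>\<in>\<Delta>. qinner ((right_deriv ^^ m) \<gamma> \<omega>) (\<gamma>' \<omega>) =
             qinner ((right_deriv ^^ m) (on_section \<Phi> \<gamma>) \<omega>) (on_section \<Phi> \<gamma>' \<omega>))))"

end

theory Submission
  imports Defs "HOL-Complex_Analysis.Complex_Analysis"
begin

text \<open>
  A unitary operator that intertwines \<open>T1\<close> and \<open>T2\<close> maps the fibres of one bundle onto those of the
  other, so the content of the theorem is the converse: the bundle determines the operator.

  Right multiplication by complex numbers makes the Hilbert space a complex one, in which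
  \<open>S_op T z\<close> factors as \<open>(T - z)(T - cnj z)\<close>. So a fibre is \<open>K(z) + K(z) \<^bold>j\<close> with the
  eigenspace \<open>K(z)\<close> of \<open>T\<close>, and differentiating the equation \<open>S_op T z (g z) = 0\<close> shows that a right
  holomorphic section satisfies \<open>T g(z) = g(z) z\<close>
  (\<open>right_holomorphic_op_ker_imp_eigenspace\<close>). Conversely, since \<open>T - z\<close> is onto, the open mapping
  theorem allows one to write down power series, on discs of locally uniform radius, that are
  sections through any given eigenvector (\<open>eigenspace_sections_exist_locally\<close>).

  Now fix a point \<open>z0\<close> of the base and an equivalence \<open>\<Phi>\<close> of the bundles, and consider the pairs
  \<open>(g\<^sup>(\<^sup>m\<^sup>)(z0), (\<Phi> g)\<^sup>(\<^sup>m\<^sup>)(z0))\<close>, where \<open>g\<close> runs through the sections near \<open>z0\<close> and \<open>m\<close> through the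
  orders of derivatives. Inner products of first components equal those of second components: the
  Hermitian condition is the case in which the second vector is not differentiated, and
  differentiating in the real direction adds derivatives there
  (\<open>qinner_higher_right_deriv_eq\<close>). Both components are total: by the identity theorem and
  connectedness, a vector orthogonal to all derivatives at \<open>z0\<close> is orthogonal to all fibres, whose
  span is dense (\<open>derivatives_of_eigensections_total\<close>). Hence the closed span of the pairs is the graph
  of a unitary operator (\<open>q_unitarily_equivalent_if_equal_inner\<close>). Finally \<open>T g(z) = g(z) z\<close> is itself
  a section, which \<open>\<Phi>\<close> sends to \<open>(\<Phi> g)(z) z\<close>; so the operator intertwines \<open>T1\<close> and \<open>T2\<close>.

  Holomorphy of vector-valued maps is reduced to scalar complex analysis by complex-linear
  functionals. The reduction loses nothing, because a locally bounded, weakly holomorphic map has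
  derivatives in norm (\<open>weakly_holomorphic_imp_right_differentiable\<close>).
\<close>

instance separable_quat_hilbert \<subseteq> banach ..

section \<open>Quaternionic scalars\<close>

lemma norm_quat_power2: "(norm p)\<^sup>2 = (qRe p)\<^sup>2 + (qI p)\<^sup>2 + (qJ p)\<^sup>2 + (qK p)\<^sup>2"
  unfolding power2_norm_eq_inner by (simp add: inner_quat_def power2_eq_square)

lemma quat_of_complex_simps [simp]:
  "quat_of_complex 0 = 0" "quat_of_complex 1 = 1"
  "quat_of_complex (a + b) = quat_of_complex a + quat_of_complex b"
  "quat_of_complex (a - b) = quat_of_complex a - quat_of_complex b"
  "quat_of_complex (- a) = - quat_of_complex a"
  "quat_of_complex (of_real r) = of_real r"
  by (simp_all add: quat_eq_iff)

lemma quat_of_complex_mult: "quat_of_complex (a * b) = quat_of_complex a * quat_of_complex b"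
  by (simp add: quat_eq_iff)

lemma norm_quat_of_complex [simp]: "norm (quat_of_complex a) = norm a"
  by (simp add: norm_quat_def inner_quat_def cmod_def power2_eq_square)

lemma inverse_quat_of_complex:
  "inverse (quat_of_complex h) = quat_of_complex (inverse h)"
proof (cases "h = 0")
  case False
  then have "quat_of_complex (inverse h) * quat_of_complex h = 1"
    by (simp flip: quat_of_complex_mult)
  then show ?thesis
    by (metis inverse_unique inverse_inverse_eq)
qed simp

lemma bounded_linear_quat_of_complex: "bounded_linear quat_of_complex"
  by (rule bounded_linear_intro[where K=1]) (simp_all add: quat_eq_iff)

lemma scaleQ_zero [simp]: "(x::'a::quat_inner) *\<^sub>Q 0 = 0" "(0::'a::quat_inner) *\<^sub>Q p = 0"
  "x *\<^sub>Q 1 = x"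
  using scaleQ_of_real[of x 0] scaleQ_of_real[of x 1] scaleQ_add_left[of "0::'a" 0 p] by simp_all

lemma qinner_scaleQ_left: "qinner (x *\<^sub>Q p) (z::'a::quat_inner) = qinner x z * p"
  using qinner_linear[of x p x 0 z] by simp

lemma qinner_scaleQ_right: "qinner (x::'a::quat_inner) (z *\<^sub>Q p) = qcnj p * qinner x z"
proof -
  have "qinner x (z *\<^sub>Q p) = qcnj (qinner z x * p)"
    by (subst qinner_commute) (simp add: qinner_scaleQ_left)
  also have "\<dots> = qcnj p * qcnj (qinner z x)"
    by (simp add: quat_eq_iff algebra_simps)
  finally show ?thesis
    using qinner_commute[of x z] by simp
qed

lemma inner_scaleQ_left: "inner (x *\<^sub>Q p) (z::'a::quat_inner) = qRe (qinner x z * p)"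
  by (metis qRe_qinner qinner_scaleQ_left)

lemma inner_scaleQ_right: "inner x ((z::'a::quat_inner) *\<^sub>Q p) = inner (x *\<^sub>Q qcnj p) z"
  by (subst qRe_qinner[symmetric]) (simp add: qinner_scaleQ_right inner_scaleQ_left)

lemma inner_scaleQ_both:
  "inner (x *\<^sub>Q p) ((z::'a::quat_inner) *\<^sub>Q q) = inner (x *\<^sub>Q (p * qcnj q)) z"
  by (simp add: inner_scaleQ_right scaleQ_scaleQ)

lemma qinner_eq_if_inner_eq:
  fixes x y x' y' :: "'a::quat_inner"
  assumes "\<And>p. inner (x *\<^sub>Q p) y = inner (x' *\<^sub>Q p) y'"
  shows "qinner x y = qinner x' y'"
  using assms[of 1] assms[of "Quat 0 1 0 0"] assms[of "Quat 0 0 1 0"] assms[of "Quat 0 0 0 1"]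
  unfolding inner_scaleQ_left by (simp add: quat_eq_iff)

lemma qinner_zero_if_inner_zero: "(\<And>p. inner (a *\<^sub>Q p) y = 0) \<Longrightarrow> qinner a (y::'a::quat_inner) = 0"
  using qinner_eq_if_inner_eq[of a y "0::'a" 0]
  by (metis inner_zero_right qinner_scaleQ_left scaleQ_zero(1) mult_zero_right)

lemma norm_scaleQ: "norm (x *\<^sub>Q p) = norm (x::'a::quat_inner) * norm p"
proof -
  have "p * qcnj p = of_real ((norm p)\<^sup>2)"
    unfolding norm_quat_power2 by (simp add: quat_eq_iff power2_eq_square algebra_simps)
  then have "inner (x *\<^sub>Q p) (x *\<^sub>Q p) = (norm x * norm p)\<^sup>2"
    by (simp add: inner_scaleQ_both scaleQ_of_real power_mult_distrib power2_norm_eq_inner del: of_real_power)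
  then show ?thesis
    by (simp add: norm_eq_sqrt_inner real_sqrt_mult)
qed

lemma bounded_bilinear_scaleQ: "bounded_bilinear (\<lambda>(x::'a::quat_inner) p. x *\<^sub>Q p)"
proof
  fix x x' :: 'a and p p' :: quat and r :: real
  have "(r *\<^sub>R x) *\<^sub>Q p = x *\<^sub>Q (of_real r * p)"
    by (metis scaleQ_of_real scaleQ_scaleQ)
  also have "of_real r * p = p * of_real r"
    by (simp add: quat_eq_iff)
  finally show "(r *\<^sub>R x) *\<^sub>Q p = r *\<^sub>R (x *\<^sub>Q p)"
    by (metis scaleQ_of_real scaleQ_scaleQ)
  have "r *\<^sub>R p = p * of_real r"
    by (simp add: quat_eq_iff)
  then show "x *\<^sub>Q (r *\<^sub>R p) = r *\<^sub>R (x *\<^sub>Q p)"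
    by (metis scaleQ_of_real scaleQ_scaleQ)
  show "\<exists>K. \<forall>a b. norm ((a::'a) *\<^sub>Q b) \<le> norm a * norm b * K"
    by (intro exI[of _ 1]) (simp add: norm_scaleQ)
qed (simp_all add: scaleQ_add_left scaleQ_add_right)

interpretation scaleQ: bounded_bilinear "\<lambda>(x::'a::quat_inner) p. x *\<^sub>Q p"
  by (rule bounded_bilinear_scaleQ)

text \<open>
  Only the scalars from \<open>\<complex>\<close> commute with each other. The right multiplications by them make the
  Hilbert space a complex one, and all holomorphy below refers to this complex structure.
\<close>

lemma scaleQ_complex_commute:
  "(x::'a::quat_inner) *\<^sub>Q quat_of_complex a *\<^sub>Q quat_of_complex b
     = x *\<^sub>Q quat_of_complex b *\<^sub>Q quat_of_complex a"
  by (simp add: scaleQ_scaleQ mult.commute flip: quat_of_complex_mult)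

lemma scaleQ_complex_inverse_cancel:
  "h \<noteq> 0 \<Longrightarrow> (x::'a::quat_inner) *\<^sub>Q inverse (quat_of_complex h) *\<^sub>Q quat_of_complex h = x"
  by (simp add: scaleQ_scaleQ inverse_quat_of_complex flip: quat_of_complex_mult)

text \<open>
  The inner product with \<open>y\<close>, cut down to its \<open>\<complex>\<close>-part in \<open>\<H> = \<complex> \<oplus> \<^bold>j\<complex>\<close>. It is linear for the
  complex structure given by right multiplication, so it turns right holomorphic maps into
  holomorphic functions, and scalar complex analysis applies to them.
\<close>

definition cpairing :: "'a::quat_inner \<Rightarrow> 'a \<Rightarrow> complex" where
  "cpairing y x = Complex (inner x y) (- inner (x *\<^sub>Q quat_of_complex \<i>) y)"

lemma cpairing_scaleQ: "cpairing y (x *\<^sub>Q quat_of_complex w) = cpairing y x * w"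
proof -
  have x: "x *\<^sub>Q quat_of_complex w = Re w *\<^sub>R x + Im w *\<^sub>R (x *\<^sub>Q quat_of_complex \<i>)" for x :: 'a
  proof -
    have "quat_of_complex w = of_real (Re w) + Im w *\<^sub>R quat_of_complex \<i>"
      by (simp add: quat_eq_iff)
    then show ?thesis
      by (simp add: scaleQ_add_right scaleQ_of_real scaleQ.scaleR_right)
  qed
  have "x *\<^sub>Q quat_of_complex \<i> *\<^sub>Q quat_of_complex \<i> = - x"
    by (simp add: scaleQ_scaleQ scaleQ.minus_right flip: quat_of_complex_mult)
  then show ?thesis
    by (simp add: cpairing_def x scaleQ_add_left scaleQ.scaleR_left inner_add_left complex_eq_iff algebra_simps)
qed

lemma cpairing_bound: "norm (cpairing y x) \<le> 2 * norm x * norm y"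
proof -
  have "norm (cpairing y x) \<le> \<bar>inner x y\<bar> + \<bar>inner (x *\<^sub>Q quat_of_complex \<i>) y\<bar>"
    using cmod_le[of "cpairing y x"] by (simp add: cpairing_def)
  also have "\<dots> \<le> norm x * norm y + norm (x *\<^sub>Q quat_of_complex \<i>) * norm y"
    by (intro add_mono Cauchy_Schwarz_ineq2)
  finally show ?thesis
    by (simp add: norm_scaleQ)
qed

lemma bounded_linear_cpairing: "bounded_linear (cpairing y)"
proof (rule bounded_linear_intro[where K="2 * norm y"])
  show "norm (cpairing y x) \<le> norm x * (2 * norm y)" for x
    using cpairing_bound[of y x] by (simp add: algebra_simps)
qed (simp_all add: cpairing_def scaleQ_add_left scaleQ.scaleR_left inner_add_left complex_eq_iff)

lemma cpairing_zero_iff: "cpairing y x = 0 \<longleftrightarrow> inner x y = 0 \<and> inner (x *\<^sub>Q quat_of_complex \<i>) y = 0"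
  by (simp add: cpairing_def complex_eq_iff)

text \<open>
  Testing with \<open>y = x\<close> gives \<open>\<parallel>x\<parallel>\<^sup>2 \<le> K \<parallel>x\<parallel>\<close>. In this way estimates for scalar functions that are
  uniform in \<open>y\<close> become estimates for vectors, without any duality theory.
\<close>

lemma norm_le_if_cpairing_le:
  assumes "\<And>y. norm (cpairing y x) \<le> K * norm y" "K \<ge> 0"
  shows "norm (x::'a::quat_inner) \<le> K"
proof -
  have "norm x * norm x \<le> norm (cpairing x x)"
    using complex_Re_le_cmod[of "cpairing x x"]
    by (simp add: cpairing_def power2_norm_eq_inner flip: power2_eq_square)
  also have "\<dots> \<le> K * norm x"
    by (rule assms(1))
  finally show ?thesis
    using assms(2) by (cases "norm x = 0") auto
qed

section \<open>Right holomorphic maps\<close>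

lemma cpairing_right_quotient:
  "cpairing y (right_quotient f z h) = (cpairing y (f (z + h)) - cpairing y (f z)) / h"
  by (simp add: right_quotient_def inverse_quat_of_complex cpairing_scaleQ divide_inverse
      linear_diff[OF bounded_linear.linear[OF bounded_linear_cpairing]])

text \<open>
  The constant depends on the bound \<open>B\<close> only, not on the function; this uniformity is what the
  passage from scalar to vector-valued maps needs. It comes from Cauchy's inequality for the second
  derivative on discs of radius \<open>r / 2\<close>.
\<close>

lemma difference_quotient_estimate:
  assumes g: "g holomorphic_on ball z r" and r: "r > 0" and B: "\<And>w. w \<in> ball z r \<Longrightarrow> norm (g w) \<le> B"
    and h: "norm h < r / 2" "h \<noteq> 0"
  shows "norm ((g (z + h) - g z) / h - deriv g z) \<le> 8 * B / r\<^sup>2 * norm h"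
proof -
  define S where "S = ball z (r / 2)"
  have D: "((deriv ^^ i) g has_field_derivative (deriv ^^ Suc i) g x) (at x within S)"
    if "x \<in> S" for x i
  proof -
    have "(deriv ^^ i) g holomorphic_on ball z r"
      by (rule holomorphic_higher_deriv[OF g]) simp
    moreover have "x \<in> ball z r"
      using that r by (auto simp: S_def)
    ultimately show ?thesis
      using holomorphic_derivI[of "(deriv ^^ i) g" "ball z r" x] by (simp add: has_field_derivative_at_within)
  qed
  have bd: "norm ((deriv ^^ Suc 1) g x) \<le> 8 * B / r\<^sup>2" if "x \<in> S" for x
  proof -
    have sub: "cball x (r / 2) \<subseteq> ball z r"
    proof
      fix w assume "w \<in> cball x (r/2)"
      then show "w \<in> ball z r"
        using that r dist_triangle[of z w x] by (simp add: S_def)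
    qed
    have "norm ((deriv ^^ 2) g x) \<le> fact 2 * B / (r / 2)\<^sup>2"
    proof (rule Cauchy_inequality)
      show "g holomorphic_on ball x (r / 2)"
        using g sub ball_subset_cball holomorphic_on_subset by blast
      show "continuous_on (cball x (r / 2)) g"
        using g sub holomorphic_on_imp_continuous_on holomorphic_on_subset by blast
      show "norm (g w) \<le> B" if "norm (x - w) = r / 2" for w
      proof -
        have "w \<in> cball x (r/2)" using that by (simp add: dist_norm)
        then show ?thesis using B sub by blast
      qed
    qed (use r in auto)
    then show ?thesis
      by (simp add: power_divide eval_nat_numeral mult.commute)
  qed
  have "norm ((deriv ^^ 0) g (z + h) - (\<Sum>i\<le>1. (deriv ^^ i) g z * ((z + h) - z) ^ i / fact i))
      \<le> 8 * B / r\<^sup>2 * norm ((z + h) - z) ^ Suc 1 / fact 1"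
    by (rule complex_Taylor[where S=S]) (use D bd h r in \<open>auto simp: S_def dist_norm\<close>)
  then have *: "norm (g (z + h) - g z - deriv g z * h) \<le> 8 * B / r\<^sup>2 * norm h * norm h"
    by (simp add: power2_eq_square algebra_simps)
  have "(g (z + h) - g z) / h - deriv g z = (g (z + h) - g z - deriv g z * h) / h"
    using h by (simp add: field_simps)
  also have "norm \<dots> \<le> 8 * B / r\<^sup>2 * norm h"
    using * h by (simp add: norm_divide pos_divide_le_eq)
  finally show ?thesis .
qed

text \<open>
  Weak holomorphy and local boundedness imply differentiability in norm: by the uniform estimate,
  two difference quotients with increments \<open>h\<close> and \<open>k\<close> differ by at most \<open>C (|h| + |k|)\<close>, so they
  converge by completeness.
\<close>

proposition weakly_holomorphic_imp_right_differentiable: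
  fixes f :: "complex \<Rightarrow> 'a::separable_quat_hilbert"
  assumes r: "r > 0" and B: "\<And>w. w \<in> ball z r \<Longrightarrow> norm (f w) \<le> B"
    and hol: "\<And>y. (\<lambda>w. cpairing y (f w)) holomorphic_on ball z r"
  shows "\<exists>D. (right_quotient f z \<longlongrightarrow> D) (at 0)"
proof -
  define C where "C = 16 * B / r\<^sup>2"
  let ?q = "right_quotient f z"
  have C0: "0 \<le> C"
    using order_trans[OF norm_ge_zero B[of z]] r by (simp add: C_def)
  have est: "norm (?q h - ?q k) \<le> C * (norm h + norm k)"
    if h: "norm h < r / 2" "h \<noteq> 0" and k: "norm k < r / 2" "k \<noteq> 0" for h k
  proof (rule norm_le_if_cpairing_le)
    fix y :: 'a
    define g where "g = (\<lambda>w. cpairing y (f w))"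
    have gB: "norm (g w) \<le> 2 * B * norm y" if "w \<in> ball z r" for w
      using cpairing_bound[of y "f w"] mult_right_mono[OF B[OF that], of "norm y"]
      by (simp add: g_def)
    have "cpairing y (?q h - ?q k) = (g (z + h) - g z) / h - (g (z + k) - g z) / k"
      by (simp add: linear_diff[OF bounded_linear.linear[OF bounded_linear_cpairing]]
          cpairing_right_quotient g_def)
    also have "\<dots> = ((g (z + h) - g z) / h - deriv g z) - ((g (z + k) - g z) / k - deriv g z)"
      by simp
    also have "norm \<dots> \<le> 8 * (2 * B * norm y) / r\<^sup>2 * norm h + 8 * (2 * B * norm y) / r\<^sup>2 * norm k"
      by (intro order_trans[OF norm_triangle_ineq4] add_mono difference_quotient_estimate[OF _ r gB])
        (use hol h k in \<open>auto simp: g_def\<close>)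
    also have "\<dots> = C * (norm h + norm k) * norm y"
      by (simp add: C_def algebra_simps add_divide_distrib)
    finally show "norm (cpairing y (?q h - ?q k)) \<le> C * (norm h + norm k) * norm y" .
  qed (use C0 in simp)
  \<comment> \<open>A null sequence of admissible increments, along which the limit is constructed.\<close>
  define e where "e n = complex_of_real (r / (2 * (2 + real n)))" for n
  have ne: "norm (e n) = r / (2 * (2 + real n))" for n
    unfolding e_def norm_of_real using r by (simp add: abs_of_pos)
  have e: "norm (e n) < r / 2" "e n \<noteq> 0" for n
  proof -
    show "norm (e n) < r / 2"
      unfolding ne using r by (simp add: divide_simps)
    then show "e n \<noteq> 0"
      using ne[of n] r by (auto simp: divide_simps)
  qed
  have e0: "(\<lambda>n. norm (e n)) \<longlonglongrightarrow> 0"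
    unfolding ne by real_asymp
  have "Cauchy (\<lambda>n. ?q (e n))"
  proof (rule metric_CauchyI)
    fix \<epsilon> :: real assume "\<epsilon> > 0"
    have "(\<lambda>n. C * norm (e n)) \<longlonglongrightarrow> C * 0"
      by (intro tendsto_intros e0)
    then have "eventually (\<lambda>n. C * norm (e n) < \<epsilon> / 2) sequentially"
      using \<open>\<epsilon> > 0\<close> by (intro order_tendstoD(2)) auto
    then obtain M where M: "\<And>n. n \<ge> M \<Longrightarrow> C * norm (e n) < \<epsilon> / 2"
      by (auto simp: eventually_sequentially)
    have "dist (?q (e m)) (?q (e n)) < \<epsilon>" if "m \<ge> M" "n \<ge> M" for m n
      using est[OF e e, of m n] M[OF that(1)] M[OF that(2)] by (simp add: dist_norm algebra_simps)
    then show "\<exists>M. \<forall>m\<ge>M. \<forall>n\<ge>M. dist (?q (e m)) (?q (e n)) < \<epsilon>"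
      by blast
  qed
  then obtain D where D: "(\<lambda>n. ?q (e n)) \<longlonglongrightarrow> D"
    using Cauchy_convergent_iff convergent_def by blast
  have lim: "norm (?q h - D) \<le> C * norm h" if h: "norm h < r / 2" "h \<noteq> 0" for h
  proof (rule LIMSEQ_le)
    show "(\<lambda>n. norm (?q h - ?q (e n))) \<longlonglongrightarrow> norm (?q h - D)"
      by (intro tendsto_intros D)
    have "(\<lambda>n. C * (norm h + norm (e n))) \<longlonglongrightarrow> C * (norm h + 0)"
      by (intro tendsto_intros e0)
    then show "(\<lambda>n. C * (norm h + norm (e n))) \<longlonglongrightarrow> C * norm h" by simp
    show "\<exists>N. \<forall>n\<ge>N. norm (?q h - ?q (e n)) \<le> C * (norm h + norm (e n))"
      using est[OF h e] by blast
  qed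
  have "((\<lambda>h. ?q h - D) \<longlongrightarrow> 0) (at 0)"
  proof (rule Lim_null_comparison)
    have "eventually (\<lambda>h. h \<in> ball 0 (r/2)) (at (0::complex))"
      by (rule eventually_at_in_open') (use r in auto)
    then show "eventually (\<lambda>h. norm (?q h - D) \<le> C * norm h) (at 0)"
      using eventually_neq_at_within[of 0 0 UNIV] by eventually_elim (use lim in auto)
    have "((\<lambda>h::complex. C * norm h) \<longlongrightarrow> C * norm (0::complex)) (at 0)"
      by (intro tendsto_intros)
    then show "((\<lambda>h::complex. C * norm h) \<longlongrightarrow> 0) (at 0)" by simp
  qed
  then show ?thesis
    using LIM_zero_iff by blast
qed

lemma right_quotient_tendsto_iff:
  "(right_quotient f z \<longlongrightarrow> D) (at 0) \<longleftrightarrow>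
     (f has_derivative (\<lambda>h. D *\<^sub>Q quat_of_complex h)) (at z)"
proof -
  have "norm (f (z + h) - f z - D *\<^sub>Q quat_of_complex h) / norm h = norm (right_quotient f z h - D)"
    if "h \<noteq> 0" for h
  proof -
    have "f (z + h) - f z - D *\<^sub>Q quat_of_complex h = (right_quotient f z h - D) *\<^sub>Q quat_of_complex h"
      by (simp add: right_quotient_def scaleQ.diff_left scaleQ_complex_inverse_cancel that)
    then show ?thesis
      using that by (simp add: norm_scaleQ)
  qed
  then have "((\<lambda>h. norm (f (z + h) - f z - D *\<^sub>Q quat_of_complex h) / norm h) \<longlongrightarrow> 0) (at 0)
      \<longleftrightarrow> ((\<lambda>h. norm (right_quotient f z h - D)) \<longlongrightarrow> 0) (at 0)"
    by (intro tendsto_cong) (auto simp: eventually_at_filter)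
  also have "\<dots> \<longleftrightarrow> (right_quotient f z \<longlongrightarrow> D) (at 0)"
    by (simp add: tendsto_norm_zero_iff LIM_zero_iff)
  moreover have "bounded_linear (\<lambda>h. D *\<^sub>Q quat_of_complex h)"
    by (rule bounded_linear_compose[OF scaleQ.bounded_linear_right bounded_linear_quat_of_complex])
  ultimately show ?thesis
    unfolding has_derivative_at by simp
qed

lemma right_deriv_eqI: "(right_quotient f z \<longlongrightarrow> D) (at 0) \<Longrightarrow> right_deriv f z = D"
  unfolding right_deriv_def by (rule tendsto_Lim) auto

lemma right_quotient_tendsto_right_deriv:
  "right_holomorphic_on f \<Delta> \<Longrightarrow> z \<in> \<Delta> \<Longrightarrow> (right_quotient f z \<longlongrightarrow> right_deriv f z) (at 0)"
  unfolding right_holomorphic_on_def using right_deriv_eqI by blast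

lemma has_derivative_right_deriv:
  "right_holomorphic_on f \<Delta> \<Longrightarrow> z \<in> \<Delta> \<Longrightarrow>
     (f has_derivative (\<lambda>h. right_deriv f z *\<^sub>Q quat_of_complex h)) (at z)"
  using right_quotient_tendsto_right_deriv right_quotient_tendsto_iff by blast

lemma right_holomorphic_on_imp_continuous_on:
  "right_holomorphic_on f \<Delta> \<Longrightarrow> continuous_on \<Delta> f"
  by (meson has_derivative_right_deriv has_derivative_continuous continuous_at_imp_continuous_on)

lemma right_holomorphic_on_subset:
  "right_holomorphic_on f \<Delta> \<Longrightarrow> \<Delta>' \<subseteq> \<Delta> \<Longrightarrow> right_holomorphic_on f \<Delta>'"
  unfolding right_holomorphic_on_def by blast

lemma right_quotient_cong:
  assumes "open \<Delta>" "z \<in> \<Delta>" "\<And>w. w \<in> \<Delta> \<Longrightarrow> f w = g w"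
  shows "eventually (\<lambda>h. right_quotient f z h = right_quotient g z h) (at 0)"
proof -
  have "open ((\<lambda>h. z + h) -` \<Delta>)"
    by (intro open_vimage assms continuous_intros)
  then have "eventually (\<lambda>h. h \<in> (\<lambda>h. z + h) -` \<Delta>) (at 0)"
    by (rule eventually_at_in_open') (use assms in auto)
  then show ?thesis
    by eventually_elim (use assms in \<open>auto simp: right_quotient_def\<close>)
qed

lemma right_deriv_cong:
  assumes "open \<Delta>" "z \<in> \<Delta>" "\<And>w. w \<in> \<Delta> \<Longrightarrow> f w = g w"
  shows "right_deriv f z = right_deriv g z"
  unfolding right_deriv_def Topological_Spaces.Lim_def
  using tendsto_cong[OF right_quotient_cong[OF assms]] by simp

lemma higher_right_deriv_cong:
  assumes "open \<Delta>" "\<And>w. w \<in> \<Delta> \<Longrightarrow> f w = g w"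
  shows "z \<in> \<Delta> \<Longrightarrow> (right_deriv ^^ m) f z = (right_deriv ^^ m) g z"
proof (induction m arbitrary: z)
  case (Suc m)
  show ?case
    using right_deriv_cong[OF assms(1) Suc.prems Suc.IH] by simp
qed (use assms in auto)

lemma cpairing_has_field_derivative:
  assumes "right_holomorphic_on f \<Delta>" "z \<in> \<Delta>"
  shows "((\<lambda>w. cpairing y (f w)) has_field_derivative cpairing y (right_deriv f z)) (at z)"
  using bounded_linear.tendsto[OF bounded_linear_cpairing right_quotient_tendsto_right_deriv[OF assms]]
  unfolding DERIV_def by (simp add: cpairing_right_quotient)

lemma cpairing_holomorphic:
  assumes "right_holomorphic_on f \<Delta>" "open \<Delta>"
  shows "(\<lambda>w. cpairing y (f w)) holomorphic_on \<Delta>"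
  using cpairing_has_field_derivative[OF assms(1)] assms(2) by (auto simp: holomorphic_on_open)

lemma right_holomorphic_onI_weak:
  fixes f :: "complex \<Rightarrow> 'a::separable_quat_hilbert"
  assumes "\<And>z. z \<in> \<Delta> \<Longrightarrow> \<exists>r B. r > 0 \<and> ball z r \<subseteq> \<Delta> \<and> (\<forall>w\<in>ball z r. norm (f w) \<le> B)"
    and "\<And>y. (\<lambda>w. cpairing y (f w)) holomorphic_on \<Delta>"
  shows "right_holomorphic_on f \<Delta>"
  unfolding right_holomorphic_on_def
proof
  fix z assume "z \<in> \<Delta>"
  then obtain r B where r: "r > 0" "ball z r \<subseteq> \<Delta>" "\<And>w. w \<in> ball z r \<Longrightarrow> norm (f w) \<le> B"
    using assms(1) by blast
  show "\<exists>D. (right_quotient f z \<longlongrightarrow> D) (at 0)"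
    by (rule weakly_holomorphic_imp_right_differentiable[OF r(1) r(3)])
      (use holomorphic_on_subset[OF assms(2) r(2)] in auto)
qed

text \<open>
  The derivative is weakly holomorphic, because its scalar parts are derivatives of holomorphic
  functions, and Cauchy's inequality bounds it locally. So the derivatives of all orders in the
  Hermitian condition on bundle maps really exist.
\<close>

proposition right_holomorphic_right_deriv:
  fixes f :: "complex \<Rightarrow> 'a::separable_quat_hilbert"
  assumes f: "right_holomorphic_on f \<Delta>" and "open \<Delta>"
  shows "right_holomorphic_on (right_deriv f) \<Delta>"
proof (rule right_holomorphic_onI_weak)
  fix y
  have "deriv (\<lambda>w. cpairing y (f w)) holomorphic_on \<Delta>"
    by (rule holomorphic_deriv[OF cpairing_holomorphic[OF assms] assms(2)])
  then show "(\<lambda>w. cpairing y (right_deriv f w)) holomorphic_on \<Delta>"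
    by (rule holomorphic_transform) (use cpairing_has_field_derivative[OF f] DERIV_imp_deriv in blast)
next
  fix z assume "z \<in> \<Delta>"
  then obtain e where e: "e > 0" "cball z e \<subseteq> \<Delta>"
    using \<open>open \<Delta>\<close> open_contains_cball by blast
  have "compact (f ` cball z e)"
    using right_holomorphic_on_imp_continuous_on[OF f] e
    by (intro compact_continuous_image) (auto intro: continuous_on_subset)
  then obtain M where M: "M > 0" "\<And>w. w \<in> cball z e \<Longrightarrow> norm (f w) \<le> M"
    using compact_imp_bounded bounded_pos by (metis image_eqI)
  define r where "r = e / 2"
  have r: "r > 0" using e r_def by simp
  have "norm (right_deriv f w) \<le> 2 * M / r" if w: "w \<in> ball z r" for w
  proof (rule norm_le_if_cpairing_le)
    fix y
    have sub: "cball w r \<subseteq> cball z e"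
    proof
      fix u assume "u \<in> cball w r"
      then show "u \<in> cball z e"
        using w dist_triangle[of z u w] by (simp add: r_def)
    qed
    have "norm ((deriv ^^ 1) (\<lambda>w. cpairing y (f w)) w) \<le> fact 1 * (2 * M * norm y) / r ^ 1"
    proof (rule Cauchy_inequality)
      have hol: "(\<lambda>w. cpairing y (f w)) holomorphic_on cball w r"
        using cpairing_holomorphic[OF assms] sub e holomorphic_on_subset by blast
      then show "(\<lambda>w. cpairing y (f w)) holomorphic_on ball w r" "continuous_on (cball w r) (\<lambda>w. cpairing y (f w))"
        using ball_subset_cball holomorphic_on_subset holomorphic_on_imp_continuous_on by blast+
      show "norm (cpairing y (f u)) \<le> 2 * M * norm y" if "norm (w - u) = r" for u
      proof -
        have "u \<in> cball w r" using that by (simp add: dist_norm)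
        then have "norm (f u) * norm y \<le> M * norm y"
          using M sub by (intro mult_right_mono) auto
        then show ?thesis
          using cpairing_bound[of y "f u"] by linarith
      qed
    qed (rule r)
    moreover have "w \<in> \<Delta>"
      using e sub r by (meson centre_in_cball less_imp_le subsetD)
    then have "deriv (\<lambda>w. cpairing y (f w)) w = cpairing y (right_deriv f w)"
      using cpairing_has_field_derivative[OF f] DERIV_imp_deriv by blast
    ultimately show "norm (cpairing y (right_deriv f w)) \<le> 2 * M / r * norm y"
      by simp
  qed (use M r in auto)
  moreover have "ball z r \<subseteq> \<Delta>"
    using e by (auto simp: r_def subset_iff)
  ultimately show "\<exists>r B. r > 0 \<and> ball z r \<subseteq> \<Delta> \<and> (\<forall>w\<in>ball z r. norm (right_deriv f w) \<le> B)"
    using r by blast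
qed

lemma right_holomorphic_higher_right_deriv:
  fixes f :: "complex \<Rightarrow> 'a::separable_quat_hilbert"
  assumes "right_holomorphic_on f \<Delta>" "open \<Delta>"
  shows "right_holomorphic_on ((right_deriv ^^ m) f) \<Delta>"
  by (induction m) (use assms right_holomorphic_right_deriv in auto)

lemma cpairing_higher_right_deriv:
  fixes f :: "complex \<Rightarrow> 'a::separable_quat_hilbert"
  assumes "right_holomorphic_on f \<Delta>" "open \<Delta>"
  shows "z \<in> \<Delta> \<Longrightarrow> cpairing y ((right_deriv ^^ m) f z) = (deriv ^^ m) (\<lambda>w. cpairing y (f w)) z"
proof (induction m arbitrary: z)
  case (Suc m)
  have "eventually (\<lambda>w. cpairing y ((right_deriv ^^ m) f w) = (deriv ^^ m) (\<lambda>w. cpairing y (f w)) w) (nhds z)"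
    using eventually_nhds_in_open[OF assms(2) Suc.prems] by eventually_elim (use Suc.IH in auto)
  then have "deriv (\<lambda>w. cpairing y ((right_deriv ^^ m) f w)) z = (deriv ^^ Suc m) (\<lambda>w. cpairing y (f w)) z"
    using deriv_cong_ev[OF _ refl] by auto
  then show ?case
    using DERIV_imp_deriv[OF cpairing_has_field_derivative[OF right_holomorphic_higher_right_deriv[OF assms] Suc.prems]]
    by simp
qed auto

lemma right_quotient_L_r:
  assumes "L \<in> L_r"
  shows "right_quotient (\<lambda>w. L (f w)) z h = L (right_quotient f z h)"
proof -
  have "linear L" "\<And>x q. L (x *\<^sub>Q q) = L x *\<^sub>Q q"
    using assms bounded_linear.linear by (auto simp: L_r_def)
  then show ?thesis
    by (simp add: right_quotient_def linear_diff)
qed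

lemma right_quotient_L_r_tendsto:
  assumes L: "L \<in> L_r" and f: "right_holomorphic_on f \<Delta>" and z: "z \<in> \<Delta>"
  shows "(right_quotient (\<lambda>w. L (f w)) z \<longlongrightarrow> L (right_deriv f z)) (at 0)"
proof -
  have "right_quotient (\<lambda>w. L (f w)) z = (\<lambda>h. L (right_quotient f z h))"
    by (rule ext) (rule right_quotient_L_r[OF L])
  moreover have "bounded_linear L"
    using L by (simp add: L_r_def)
  ultimately show ?thesis
    using bounded_linear.tendsto[OF _ right_quotient_tendsto_right_deriv[OF f z]] by metis
qed

lemma right_holomorphic_L_r:
  "L \<in> L_r \<Longrightarrow> right_holomorphic_on f \<Delta> \<Longrightarrow> right_holomorphic_on (\<lambda>w. L (f w)) \<Delta>"
  unfolding right_holomorphic_on_def[of "\<lambda>w. L (f w)"] using right_quotient_L_r_tendsto by blast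

lemma higher_right_deriv_L_r:
  fixes f :: "complex \<Rightarrow> 'a::separable_quat_hilbert"
  assumes L: "L \<in> L_r" and f: "right_holomorphic_on f \<Delta>" and "open \<Delta>"
  shows "z \<in> \<Delta> \<Longrightarrow> (right_deriv ^^ m) (\<lambda>w. L (f w)) z = L ((right_deriv ^^ m) f z)"
proof (induction m arbitrary: z)
  case (Suc m)
  have "(right_deriv ^^ Suc m) (\<lambda>w. L (f w)) z = right_deriv (\<lambda>w. L ((right_deriv ^^ m) f w)) z"
    using right_deriv_cong[OF \<open>open \<Delta>\<close> Suc.prems Suc.IH] by simp
  also have "\<dots> = L ((right_deriv ^^ Suc m) f z)"
    using right_deriv_eqI[OF right_quotient_L_r_tendsto[OF L right_holomorphic_higher_right_deriv[OF f \<open>open \<Delta>\<close>] Suc.prems]]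
    by simp
  finally show ?case .
qed simp

text \<open>
  Half of the radius of convergence given by the bounds is kept, so that the series is dominated by
  a geometric one; a power series is weakly holomorphic by the scalar theory.
\<close>

proposition right_power_series:
  fixes x :: "nat \<Rightarrow> 'a::separable_quat_hilbert" and w :: complex
  assumes C: "C > 0" and x: "\<And>k. norm (x k) \<le> C ^ k * N"
  defines "f \<equiv> (\<lambda>z. \<Sum>k. x k *\<^sub>Q quat_of_complex ((z - w) ^ k))"
  shows "z \<in> ball w (1 / (2 * C)) \<Longrightarrow> (\<lambda>k. x k *\<^sub>Q quat_of_complex ((z - w) ^ k)) sums f z"
    and "right_holomorphic_on f (ball w (1 / (2 * C)))"
proof -
  have N: "N \<ge> 0"
    using order_trans[OF norm_ge_zero x[of 0]] by simp
  define t where "t z k = x k *\<^sub>Q quat_of_complex ((z - w) ^ k)" for z k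
  have bd: "norm (t z k) \<le> N * (1 / 2) ^ k"
    if "z \<in> ball w (1 / (2 * C))" for z k
  proof -
    have "norm (z - w) < 1 / (2 * C)"
      using that by (simp add: dist_norm norm_minus_commute)
    then have "C * norm (z - w) \<le> 1 / 2"
      using C by (simp add: field_simps)
    then have 1: "(C * norm (z - w)) ^ k \<le> (1 / 2) ^ k"
      by (intro power_mono) (use C in auto)
    have "norm (t z k) = norm (x k) * norm (z - w) ^ k"
      by (simp add: t_def norm_scaleQ norm_power)
    also have "\<dots> \<le> C ^ k * N * norm (z - w) ^ k"
      by (intro mult_right_mono x) simp
    also have "\<dots> = N * (C * norm (z - w)) ^ k"
      by (simp only: power_mult_distrib mult_ac)
    also have "\<dots> \<le> N * (1 / 2) ^ k"
      using 1 N by (rule mult_left_mono)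
    finally show ?thesis .
  qed
  have sm: "summable (\<lambda>k. N * (1 / 2) ^ k)"
    by (intro summable_mult summable_geometric) simp
  have smt: "summable (t z)" if "z \<in> ball w (1 / (2 * C))" for z
    by (rule summable_comparison_test'[OF sm bd[OF that]])
  have f: "f z = suminf (t z)" for z
    by (simp add: f_def t_def [abs_def])
  have sums: "t z sums f z" if "z \<in> ball w (1 / (2 * C))" for z
    unfolding f by (rule summable_sums[OF smt[OF that]])
  then show "(\<lambda>k. x k *\<^sub>Q quat_of_complex ((z - w) ^ k)) sums f z" if "z \<in> ball w (1 / (2 * C))" for z
    using that by (simp add: t_def [abs_def])
  have nf: "norm (f z) \<le> (\<Sum>k. N * (1 / 2) ^ k)" if "z \<in> ball w (1 / (2 * C))" for z
    unfolding f by (rule norm_suminf_le[OF bd[OF that] sm])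
  show "right_holomorphic_on f (ball w (1 / (2 * C)))"
  proof (rule right_holomorphic_onI_weak)
    fix y
    show "(\<lambda>z. cpairing y (f z)) holomorphic_on ball w (1 / (2 * C))"
    proof (rule power_series_holomorphic)
      fix z assume z: "z \<in> ball w (1 / (2 * C))"
      have "(\<lambda>k. cpairing y (t z k)) = (\<lambda>k. cpairing y (x k) * (z - w) ^ k)"
        by (simp only: t_def cpairing_scaleQ)
      then show "(\<lambda>k. cpairing y (x k) * (z - w) ^ k) sums cpairing y (f z)"
        using bounded_linear.sums[OF bounded_linear_cpairing sums[OF z], of y] by metis
    qed
  next
    fix z assume "z \<in> ball w (1 / (2 * C))"
    then obtain r where "r > 0" "ball z r \<subseteq> ball w (1 / (2 * C))"
      using open_contains_ball[of "ball w (1 / (2 * C))"] open_ball by blast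
    then show "\<exists>r B. r > 0 \<and> ball z r \<subseteq> ball w (1 / (2 * C)) \<and> (\<forall>u\<in>ball z r. norm (f u) \<le> B)"
      using nf by blast
  qed
qed

section \<open>Surjective bounded operators\<close>

text \<open>
  Solving approximately, and then solving for the error again and again, gives a geometric series.
  The lemma serves twice: in the open mapping theorem, where Baire's theorem gives approximate
  solutions only, and for small perturbations of a surjective operator, for which solutions of the
  unperturbed equation are approximate solutions.
\<close>

lemma bounded_preimage_if_approximate:
  fixes A :: "'a::banach \<Rightarrow> 'b::real_normed_vector"
  assumes A: "bounded_linear A"
    and approx: "\<And>y. \<exists>x. norm x \<le> C * norm y \<and> norm (y - A x) \<le> norm y / 2"
  shows "\<exists>x. A x = y \<and> norm x \<le> 2 * C * norm y"
proof -
  obtain s where s: "\<And>y. norm (s y) \<le> C * norm y" "\<And>y. norm (y - A (s y)) \<le> norm y / 2"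
    using approx by metis
  define r where "r k = ((\<lambda>v. v - A (s v)) ^^ k) y" for k
  have r_Suc: "r (Suc k) = r k - A (s (r k))" for k
    by (simp add: r_def)
  have r_le: "norm (r k) \<le> norm y * (1 / 2) ^ k" for k
  proof (induction k)
    case (Suc k)
    have "norm (r (Suc k)) \<le> norm (r k) / 2"
      unfolding r_Suc by (rule s(2))
    then show ?case
      using Suc by simp
  qed (simp add: r_def)
  have C: "C * norm y \<ge> 0" for y :: 'b
    using order_trans[OF norm_ge_zero s(1)] .
  have s_le: "norm (s (r k)) \<le> C * norm y * (1 / 2) ^ k" for k
  proof (cases "y = 0")
    case True
    then show ?thesis using s(1)[of "r k"] r_le[of k] by simp
  next
    case False
    then have "C \<ge> 0"
      using C[of y] by (simp add: zero_le_mult_iff)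
    then have "C * norm (r k) \<le> C * (norm y * (1 / 2) ^ k)"
      by (intro mult_left_mono r_le)
    then show ?thesis using s(1)[of "r k"] by (simp add: mult_ac)
  qed
  have geo: "(\<lambda>k. C * norm y * (1 / 2) ^ k) sums (C * norm y * 2)"
    using sums_mult[OF geometric_sums[of "1/2 :: real"], of "C * norm y"] by simp
  have "summable (\<lambda>k. s (r k))"
    by (rule summable_comparison_test'[OF sums_summable[OF geo]]) (rule s_le)
  then have sums: "(\<lambda>k. s (r k)) sums (\<Sum>k. s (r k))"
    by (rule summable_sums)
  have r_lim: "r \<longlonglongrightarrow> 0"
  proof (rule Lim_null_comparison)
    show "eventually (\<lambda>k. norm (r k) \<le> norm y * (1 / 2) ^ k) sequentially"
      using r_le by simp
    show "(\<lambda>k. norm y * (1 / 2) ^ k) \<longlonglongrightarrow> 0"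
      by (intro tendsto_mult_right_zero LIMSEQ_power_zero) simp
  qed
  have "(\<lambda>k. A (s (r k))) sums (r 0 - 0)"
    using telescope_sums'[OF r_lim] by (simp add: r_Suc)
  then have "A (\<Sum>k. s (r k)) = y"
    using bounded_linear.sums[OF A sums] sums_unique2 by (fastforce simp: r_def)
  moreover have "norm (\<Sum>k. s (r k)) \<le> C * norm y * 2"
    using norm_suminf_le[OF s_le sums_summable[OF geo]] geo sums_unique by metis
  ultimately show ?thesis
    by (auto simp: mult_ac)
qed

lemma Baire_banach_cover:
  fixes F :: "nat \<Rightarrow> 'b::banach set"
  assumes "\<And>n. closed (F n)" "(\<Union>n. F n) = UNIV"
  shows "\<exists>n. interior (F n) \<noteq> {}"
proof (rule ccontr)
  assume none: "\<not> ?thesis"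
  have "Met_TC.mtopology interior_of \<Union> (range F) = {}"
  proof (rule Met_TC.metric_Baire_category_alt)
    show "Met_TC.mcomplete TYPE('b)"
      using complete_UNIV mcomplete_iff_complete by blast
    show "closedin Met_TC.mtopology T \<and> Met_TC.mtopology interior_of T = {}"
      if "T \<in> range F" for T
      using that assms(1) none by (auto simp only: mtopology_is_euclidean euclidean_interior_of closed_closedin)
  qed simp
  then have "interior (\<Union> (range F)) = {}"
    by (simp only: mtopology_is_euclidean euclidean_interior_of)
  then show False
    using assms(2) by simp
qed

text \<open>
  The open mapping theorem. By Baire's theorem the closure of the image of some ball contains a
  ball, so that the equation \<open>A x = y\<close> has approximate solutions of controlled norm.
\<close>

theorem surjective_imp_bounded_preimage:
  fixes A :: "'a::banach \<Rightarrow> 'b::banach"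
  assumes A: "bounded_linear A" and surj: "surj A"
  shows "\<exists>C>0. \<forall>y. \<exists>x. A x = y \<and> norm x \<le> C * norm y"
proof -
  interpret bounded_linear A by (rule A)
  let ?F = "\<lambda>n::nat. closure (A ` ball 0 (real n))"
  have "(\<Union>n. ?F n) = UNIV"
  proof -
    have "y \<in> (\<Union>n. ?F n)" for y
    proof -
      obtain x where "y = A x" using surj by (rule surjE)
      moreover obtain n where "norm x < real n" using reals_Archimedean2 by blast
      ultimately have "y \<in> A ` ball 0 (real n)" by (simp add: mem_ball_0)
      then have "y \<in> ?F n" by (rule subsetD[OF closure_subset])
      then show ?thesis by (rule UN_I[OF UNIV_I])
    qed
    then show ?thesis by (intro equalityI subsetI UNIV_I)
  qed
  then obtain n where "interior (?F n) \<noteq> {}"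
    using Baire_banach_cover[of ?F] closed_closure by blast
  then obtain b e where e: "e > 0" "ball b e \<subseteq> ?F n"
    unfolding ex_in_conv[symmetric] mem_interior by blast
  have dense: "\<exists>x. norm x \<le> 2 * real n \<and> norm (y - A x) < d" if y: "norm y < e" and d: "d > 0" for y d
  proof -
    have "b + y \<in> ball b e" "b \<in> ball b e"
      using e y by (simp_all add: dist_norm)
    then have "b + y \<in> ?F n" "b \<in> ?F n"
      using e(2) by blast+
    moreover have "d / 2 > 0" using d by simp
    ultimately have "\<exists>v\<in>A ` ball 0 (real n). dist v (b + y) < d / 2"
        "\<exists>v\<in>A ` ball 0 (real n). dist v b < d / 2"
      unfolding closure_approachable by blast+
    then obtain p q where p: "norm p < n" "dist (A p) (b + y) < d / 2"
        and q: "norm q < n" "dist (A q) b < d / 2"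
      by (force simp: mem_ball_0)
    have "y - A (p - q) = (A q - b) - (A p - (b + y))"
      by (simp add: diff)
    then have "norm (y - A (p - q)) \<le> norm (A q - b) + norm (A p - (b + y))"
      using norm_triangle_ineq4[of "A q - b" "A p - (b + y)"] by metis
    then have "norm (y - A (p - q)) < d"
      using p(2) q(2) unfolding dist_norm by linarith
    moreover have "norm (p - q) \<le> 2 * real n"
      using norm_triangle_ineq4[of p q] p(1) q(1) by simp
    ultimately show ?thesis by blast
  qed
  define C where "C = 4 * real n / e"
  have approx: "\<exists>x. norm x \<le> C * norm y \<and> norm (y - A x) \<le> norm y / 2" for y
  proof (cases "y = 0")
    case False
    \<comment> \<open>The factor moves \<open>y\<close> to norm \<open>e / 2\<close>, inside the ball in which approximate solutions exist;
      an error of \<open>e / 4\<close> there is half of the norm.\<close>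
    define t where "t = e / (2 * norm y)"
    have t: "t > 0" using False e(1) t_def by simp
    have ny: "norm (t *\<^sub>R y) = e / 2"
      using e(1) False by (simp add: t_def)
    obtain x where x: "norm x \<le> 2 * real n" "norm (t *\<^sub>R y - A x) < e / 4"
    proof -
      have "norm (t *\<^sub>R y) < e" "e / 4 > 0"
        using e(1) unfolding ny by simp_all
      then show thesis
        using dense that by blast
    qed
    have "norm (x /\<^sub>R t) = norm x / t"
      unfolding norm_scaleR using t by (simp add: divide_inverse)
    also have "\<dots> \<le> 2 * real n / t"
      using x t by (intro divide_right_mono) auto
    also have "\<dots> = C * norm y"
      using e(1) False by (simp add: C_def t_def)
    finally have 1: "norm (x /\<^sub>R t) \<le> C * norm y" .
    have "y - A (x /\<^sub>R t) = (t *\<^sub>R y - A x) /\<^sub>R t"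
      using t by (simp add: scaleR scaleR_right_diff_distrib)
    then have "norm (y - A (x /\<^sub>R t)) = norm (t *\<^sub>R y - A x) / t"
      using t by (simp only: norm_scaleR) (simp add: divide_inverse)
    also have "\<dots> \<le> (e / 4) / t"
      using x t by (intro divide_right_mono) auto
    also have "\<dots> = norm y / 2"
      using e(1) False by (simp add: t_def)
    finally show ?thesis using 1 by blast
  next
    case True
    then show ?thesis
      by (intro exI[of _ 0]) (simp add: zero)
  qed
  have "\<exists>x. A x = y \<and> norm x \<le> (2 * C + 1) * norm y" for y
  proof -
    obtain x where "A x = y" "norm x \<le> 2 * C * norm y"
      using bounded_preimage_if_approximate[OF A approx] by blast
    then show ?thesis
      by (intro exI[of _ x]) (simp add: distrib_right add_increasing2)
  qed
  moreover have "2 * C + 1 > 0"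
    using e(1) by (simp add: C_def add_nonneg_pos)
  ultimately show ?thesis by blast
qed

section \<open>Eigenvectors and sections\<close>

lemma L_r_simps:
  assumes "T \<in> L_r"
  shows "T (x + y) = T x + T y" "T (x - y) = T x - T y" "T (- x) = - T x" "T 0 = 0"
    "T (r *\<^sub>R x) = r *\<^sub>R T x" "T (x *\<^sub>Q q) = T x *\<^sub>Q q"
proof -
  have "linear T" using assms bounded_linear.linear by (auto simp: L_r_def)
  then show "T (x + y) = T x + T y" "T (x - y) = T x - T y" "T (- x) = - T x" "T 0 = 0"
    "T (r *\<^sub>R x) = r *\<^sub>R T x"
    by (simp_all add: linear_add linear_diff linear_neg linear_0 linear_cmul)
  show "T (x *\<^sub>Q q) = T x *\<^sub>Q q" using assms by (auto simp: L_r_def)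
qed

text \<open>
  The eigenvectors of \<open>T\<close> as an operator on the complex Hilbert space.
\<close>

definition eigenspace :: "('a::quat_inner \<Rightarrow> 'a) \<Rightarrow> complex \<Rightarrow> 'a set" where
  "eigenspace T z = {x. T x = x *\<^sub>Q quat_of_complex z}"

text \<open>
  As \<open>T\<close> commutes with the right multiplications, the quadratic operator factors over \<open>\<complex>\<close> like the
  polynomial \<open>t\<^sup>2 - 2 Re(z) t + |z|\<^sup>2 = (t - z)(t - cnj z)\<close>.
\<close>

lemma S_op_factorization:
  assumes T: "T \<in> L_r"
  defines "A \<equiv> \<lambda>z x. T x - x *\<^sub>Q quat_of_complex z"
  shows "S_op T (quat_of_complex z) x = A z (A (cnj z) x)"
    and "S_op T (quat_of_complex z) x = A (cnj z) (A z x)"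
proof -
  have 1: "T x *\<^sub>Q quat_of_complex z + T x *\<^sub>Q quat_of_complex (cnj z) = (2 * Re z) *\<^sub>R T x"
    by (metis scaleQ_add_right quat_of_complex_simps(3) complex_add_cnj quat_of_complex_simps(6) scaleQ_of_real)
  have "quat_of_complex z * quat_of_complex (cnj z) = of_real ((norm z)\<^sup>2)"
    by (metis complex_norm_square quat_of_complex_mult quat_of_complex_simps(6))
  then have 2: "x *\<^sub>Q quat_of_complex z *\<^sub>Q quat_of_complex (cnj z) = (norm z)\<^sup>2 *\<^sub>R x"
    by (metis scaleQ_of_real scaleQ_scaleQ)
  show "S_op T (quat_of_complex z) x = A (cnj z) (A z x)"
    unfolding S_op_def A_def using 1 2 by (simp add: L_r_simps[OF T] scaleQ.diff_left algebra_simps)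
  show "S_op T (quat_of_complex z) x = A z (A (cnj z) x)"
    unfolding S_op_def A_def using 1 2
    by (simp add: L_r_simps[OF T] scaleQ.diff_left scaleQ_complex_commute[of x "cnj z" z] algebra_simps)
qed

lemma S_op_L_r:
  assumes T: "T \<in> L_r"
  shows "S_op T s \<in> L_r"
proof -
  have b: "bounded_linear T" using T by (simp add: L_r_def)
  have "bounded_linear (S_op T s)"
    unfolding S_op_def
    by (intro bounded_linear_add bounded_linear_sub bounded_linear_compose[OF b] b
        bounded_linear_const_scaleR bounded_linear_ident)
  then show ?thesis
    using L_r_simps[OF T]
    by (simp add: L_r_def S_op_def scaleQ.diff_left scaleQ_add_left scaleQ.scaleR_left)
qed

lemma eigenspace_subset_op_ker:
  "T \<in> L_r \<Longrightarrow> x \<in> eigenspace T z \<Longrightarrow> x \<in> op_ker (S_op T (quat_of_complex z))"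
  by (simp add: op_ker_def S_op_factorization(2) eigenspace_def L_r_simps)

text \<open>
  For nonreal \<open>z\<close> the two factors of the quadratic operator are coprime, so that its kernel is the
  sum of the eigenspaces for \<open>z\<close> and for \<open>cnj z\<close>. Right multiplication by \<open>\<^bold>j\<close> exchanges these two,
  because \<open>cnj z \<^bold>j = \<^bold>j z\<close>.
\<close>

lemma op_ker_decomposition:
  assumes T: "T \<in> L_r" and z: "Im z \<noteq> 0" and x: "x \<in> op_ker (S_op T (quat_of_complex z))"
  shows "\<exists>u\<in>eigenspace T z. \<exists>v\<in>eigenspace T z. x = u + v *\<^sub>Q Quat 0 0 1 0"
proof -
  define A where "A = (\<lambda>w x. T x - x *\<^sub>Q quat_of_complex w)"
  define d where "d = inverse (z - cnj z)"
  have A0: "A z (A (cnj z) x) = 0" "A (cnj z) (A z x) = 0"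
    using x S_op_factorization[OF T, of z x] by (simp_all add: op_ker_def A_def)
  define u v' where "u = A (cnj z) x *\<^sub>Q quat_of_complex d" and "v' = A z x *\<^sub>Q quat_of_complex (- d)"
  define v where "v = v' *\<^sub>Q Quat 0 0 (-1) 0"
  have A_scale: "A w (y *\<^sub>Q quat_of_complex c) = A w y *\<^sub>Q quat_of_complex c" for w y c
    by (simp add: A_def L_r_simps[OF T] scaleQ.diff_left scaleQ_complex_commute)
  have "A z u = 0" "A (cnj z) v' = 0"
    by (simp_all only: u_def v'_def A_scale A0 scaleQ_zero)
  then have Tu: "T u = u *\<^sub>Q quat_of_complex z" and Tv': "T v' = v' *\<^sub>Q quat_of_complex (cnj z)"
    by (simp_all add: A_def)
  have "quat_of_complex (cnj z) * Quat 0 0 (-1) 0 = Quat 0 0 (-1) 0 * quat_of_complex z"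
    by (simp add: quat_eq_iff)
  then have Tv: "T v = v *\<^sub>Q quat_of_complex z"
    by (simp add: v_def L_r_simps[OF T] Tv' scaleQ_scaleQ)
  have "u + v' = (A (cnj z) x - A z x) *\<^sub>Q quat_of_complex d"
    by (simp add: u_def v'_def scaleQ.diff_left scaleQ.minus_right)
  also have "A (cnj z) x - A z x = x *\<^sub>Q quat_of_complex (z - cnj z)"
    by (simp add: A_def scaleQ.diff_right)
  also have "\<dots> *\<^sub>Q quat_of_complex d = x"
  proof -
    have "z - cnj z \<noteq> 0" using z by (simp add: complex_eq_iff)
    then have "(z - cnj z) * d = 1" by (simp add: d_def)
    then show ?thesis
      by (metis scaleQ_scaleQ quat_of_complex_mult quat_of_complex_simps(2) scaleQ_zero(3))
  qed
  finally have "u + v' = x" .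
  moreover have "Quat 0 0 (-1) 0 * Quat 0 0 1 0 = 1"
    by (simp add: quat_eq_iff)
  then have "v *\<^sub>Q Quat 0 0 1 0 = v'"
    by (simp add: v_def scaleQ_scaleQ)
  ultimately show ?thesis
    using Tu Tv by (auto simp: eigenspace_def)
qed

text \<open>
  A fibre contains eigenvectors for \<open>z\<close> and for \<open>cnj z\<close>, but a holomorphic section takes its values
  in the first eigenspace: applying the Cauchy--Riemann operator to the equation
  \<open>T\<^sup>2 g - T g (z + cnj z) + g z cnj z = 0\<close>, only the derivatives of the coefficients with respect to
  \<open>cnj z\<close> survive, and they give \<open>- T g + g z = 0\<close>. In real terms, this compares the
  derivatives in the directions \<open>1\<close> and \<open>\<i>\<close>.
\<close>

lemma right_holomorphic_op_ker_imp_eigenspace: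
  fixes g :: "complex \<Rightarrow> 'a::separable_quat_hilbert"
  assumes T: "T \<in> L_r" and g: "right_holomorphic_on g \<Delta>" and "open \<Delta>"
    and ker: "\<And>w. w \<in> \<Delta> \<Longrightarrow> g w \<in> op_ker (S_op T (quat_of_complex w))" and z: "z \<in> \<Delta>"
  shows "g z \<in> eigenspace T z"
proof -
  define D where "D = right_deriv g z"
  let ?i = "quat_of_complex \<i>"
  define F where "F w = T (T (g w)) - (2 * Re w) *\<^sub>R T (g w) + ((Re w)\<^sup>2 + (Im w)\<^sup>2) *\<^sub>R g w" for w
  define G where "G h = S_op T (quat_of_complex z) (D *\<^sub>Q quat_of_complex h)
      - (2 * Re h) *\<^sub>R T (g z) + (2 * Re z * Re h + 2 * Im z * Im h) *\<^sub>R g z" for h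
  have b: "bounded_linear T" using T by (simp add: L_r_def)
  have dg: "(g has_derivative (\<lambda>h. D *\<^sub>Q quat_of_complex h)) (at z)"
    unfolding D_def by (rule has_derivative_right_deriv[OF g z])
  note dT = bounded_linear.has_derivative[OF b]
  have "(F has_derivative G) (at z)"
    unfolding F_def [abs_def]
    apply (rule has_derivative_eq_rhs)
     apply (rule derivative_intros dg dT)+
    apply (simp add: G_def [abs_def] S_op_def cmod_power2 fun_eq_iff algebra_simps)
    done
  moreover have "(F has_derivative (\<lambda>h. 0)) (at z)"
  proof (rule has_derivative_transform_within_open[OF has_derivative_const \<open>open \<Delta>\<close> z])
    show "0 = F w" if "w \<in> \<Delta>" for w
      using ker[OF that] by (simp add: op_ker_def S_op_def F_def cmod_power2)
  qed
  ultimately have G0: "G h = 0" for h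
    using has_derivative_unique by metis
  define s where "s = S_op T (quat_of_complex z) D"
  have ii: "s *\<^sub>Q ?i *\<^sub>Q ?i = - s"
    by (simp add: scaleQ_scaleQ scaleQ.minus_right flip: quat_of_complex_mult)
  have "G 1 = 0" "G \<i> *\<^sub>Q ?i = 0"
    by (simp_all add: G0)
  then have "s - 2 *\<^sub>R T (g z) + (2 * Re z) *\<^sub>R g z = 0" "- s + (2 * Im z) *\<^sub>R (g z *\<^sub>Q ?i) = 0"
    by (simp_all add: G_def L_r_simps[OF S_op_L_r[OF T]] scaleQ_add_left scaleQ.scaleR_left ii flip: s_def)
  then have "2 *\<^sub>R T (g z) = 2 *\<^sub>R (Re z *\<^sub>R g z + Im z *\<^sub>R (g z *\<^sub>Q ?i))"
    by (simp add: algebra_simps)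
  moreover have "quat_of_complex z = of_real (Re z) + Im z *\<^sub>R ?i"
    by (simp add: quat_eq_iff)
  ultimately show ?thesis
    by (simp add: eigenspace_def scaleQ_add_right scaleQ_of_real scaleQ.scaleR_right)
qed

text \<open>
  Surjectivity of \<open>S_op\<close> passes to its left factor \<open>T - z\<close>, and the bound on solutions
  survives a change of \<open>z\<close> that is small compared with its inverse.
\<close>

lemma locally_uniform_bounded_preimage:
  fixes T :: "'a::separable_quat_hilbert \<Rightarrow> 'a"
  assumes T: "T \<in> L_r" and surj: "range (S_op T (quat_of_complex z)) = UNIV"
  shows "\<exists>C>0. \<exists>e>0. \<forall>w\<in>ball z e. \<forall>y. \<exists>x. T x - x *\<^sub>Q quat_of_complex w = y \<and> norm x \<le> C * norm y"
proof -
  define A where "A w x = T x - x *\<^sub>Q quat_of_complex w" for w x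
  have A: "bounded_linear (A w)" for w
    unfolding A_def using T by (intro bounded_linear_sub scaleQ.bounded_linear_left) (simp add: L_r_def)
  have "surj (A z)"
    using surj S_op_factorization(1)[OF T, of z] unfolding A_def surj_def by metis
  then obtain C where C: "C > 0" "\<And>y. \<exists>x. A z x = y \<and> norm x \<le> C * norm y"
    using surjective_imp_bounded_preimage[OF A] by blast
  have "\<exists>x. A w x = y \<and> norm x \<le> 2 * C * norm y" if w: "w \<in> ball z (1 / (2 * C))" for w y
  proof (rule bounded_preimage_if_approximate[OF A])
    fix y
    obtain x where x: "A z x = y" "norm x \<le> C * norm y" using C by blast
    have "y - A w x = x *\<^sub>Q quat_of_complex (w - z)"
      by (simp add: x(1)[symmetric] A_def scaleQ.diff_right)
    then have "norm (y - A w x) = norm x * norm (w - z)"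
      by (simp only: norm_scaleQ norm_quat_of_complex)
    also have "\<dots> \<le> (C * norm y) * (1 / (2 * C))"
      using x w C(1) by (intro mult_mono) (auto simp: dist_norm norm_minus_commute)
    also have "\<dots> = norm y / 2" using C by simp
    finally show "\<exists>x. norm x \<le> C * norm y \<and> norm (y - A w x) \<le> norm y / 2"
      using x by blast
  qed
  then show ?thesis
    unfolding A_def using C(1) by (intro exI[of _ "2 * C"] conjI exI[of _ "1 / (2 * C)"]) auto
qed

text \<open>
  With \<open>x\<^sub>0 = a\<close> and \<open>(T - z) x\<^sub>k\<^sub>+\<^sub>1 = x\<^sub>k\<close>, the map \<open>g(w) = \<Sum>\<^sub>k x\<^sub>k (w - z)\<^sup>k\<close> satisfies
  \<open>(T - z) g(w) = g(w) (w - z)\<close>. The bound on the solutions gives a radius of convergence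
  independent of \<open>a\<close>.
\<close>

lemma eigenspace_section_through:
  fixes T :: "'a::separable_quat_hilbert \<Rightarrow> 'a"
  assumes T: "T \<in> L_r" and C: "C > 0"
    and pre: "\<And>y. \<exists>x. T x - x *\<^sub>Q quat_of_complex z = y \<and> norm x \<le> C * norm y"
    and a: "a \<in> eigenspace T z"
  shows "\<exists>g. right_holomorphic_on g (ball z (1 / (2 * C))) \<and> g z = a \<and>
           (\<forall>w\<in>ball z (1 / (2 * C)). g w \<in> eigenspace T w)"
proof -
  obtain s where s: "\<And>y. T (s y) - s y *\<^sub>Q quat_of_complex z = y" "\<And>y. norm (s y) \<le> C * norm y"
    using pre by metis
  define x where "x k = (s ^^ k) a" for k
  have x0: "x 0 = a" and x_Suc: "x (Suc k) = s (x k)" for k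
    by (simp_all add: x_def)
  have nx: "norm (x k) \<le> C ^ k * norm a" for k
  proof (induction k)
    case (Suc k)
    have "norm (x (Suc k)) \<le> C * norm (x k)"
      using s(2) x_Suc by simp
    also have "\<dots> \<le> C * (C ^ k * norm a)"
      using Suc C by (intro mult_left_mono) auto
    finally show ?case by (simp add: mult_ac)
  qed (simp add: x0)
  define g where "g w = (\<Sum>k. x k *\<^sub>Q quat_of_complex ((w - z) ^ k))" for w
  note ps = right_power_series[where w=z, OF C nx, folded g_def]
  have "g w \<in> eigenspace T w" if w: "w \<in> ball z (1 / (2 * C))" for w
  proof -
    let ?t = "\<lambda>k. x k *\<^sub>Q quat_of_complex ((w - z) ^ k)"
    have b: "bounded_linear T" using T by (simp add: L_r_def)
    have sm: "?t sums g w" by (rule ps(1)[OF w])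
    have "(\<lambda>k. T (?t k) - ?t k *\<^sub>Q quat_of_complex z) sums (T (g w) - g w *\<^sub>Q quat_of_complex z)"
      by (intro sums_diff bounded_linear.sums[OF b] bounded_linear.sums[OF scaleQ.bounded_linear_left] sm)
    moreover have "(\<lambda>k. T (?t k) - ?t k *\<^sub>Q quat_of_complex z) sums (g w *\<^sub>Q quat_of_complex (w - z))"
    proof -
      define t' where "t' k = T (?t k) - ?t k *\<^sub>Q quat_of_complex z" for k
      have t': "t' k = (T (x k) - x k *\<^sub>Q quat_of_complex z) *\<^sub>Q quat_of_complex ((w - z) ^ k)" for k
        unfolding t'_def by (simp only: L_r_simps[OF T] scaleQ.diff_left scaleQ_complex_commute[of _ _ z])
      have "t' (Suc k) = ?t k *\<^sub>Q quat_of_complex (w - z)" for k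
        unfolding t' x_Suc s(1) by (simp add: scaleQ_scaleQ mult.commute flip: quat_of_complex_mult del: quat_of_complex_simps)
      then have "(\<lambda>k. t' (Suc k)) sums (g w *\<^sub>Q quat_of_complex (w - z))"
        using bounded_linear.sums[OF scaleQ.bounded_linear_left sm, of "quat_of_complex (w - z)"] by simp
      moreover have "t' 0 = 0"
        unfolding t' x0 using a by (simp add: eigenspace_def)
      ultimately show ?thesis
        using sums_Suc_iff[of t'] unfolding t'_def by simp
    qed
    ultimately have "T (g w) - g w *\<^sub>Q quat_of_complex z = g w *\<^sub>Q quat_of_complex (w - z)"
      by (rule sums_unique2)
    then show ?thesis
      by (simp add: eigenspace_def scaleQ.diff_right)
  qed
  moreover have "g z = a"
  proof -
    have "(\<lambda>k. x k *\<^sub>Q quat_of_complex ((z - z) ^ k)) sums g z"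
      using ps(1)[of z] C by simp
    moreover have "(\<lambda>k. x k *\<^sub>Q quat_of_complex ((z - z) ^ k)) sums (\<Sum>k\<in>{0}. x k *\<^sub>Q quat_of_complex ((z - z) ^ k))"
      by (rule sums_finite) (auto simp: power_0_left)
    ultimately show ?thesis
      using sums_unique2 x0 by fastforce
  qed
  ultimately show ?thesis
    using ps(2) by blast
qed

section \<open>Unitary operators from equal inner products\<close>

lemma subspace_closure:
  fixes M :: "'a::real_normed_vector set"
  assumes "subspace M"
  shows "subspace (closure M)"
proof (rule subspaceI)
  show "0 \<in> closure M"
    using subspace_0[OF assms] closure_subset by (rule subsetD[rotated])
next
  fix x y assume "x \<in> closure M" "y \<in> closure M"
  then obtain f g where "\<And>n. f n \<in> M" "f \<longlonglongrightarrow> x" "\<And>n. g n \<in> M" "g \<longlonglongrightarrow> y"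
    unfolding closure_sequential by metis
  then have "\<And>n. f n + g n \<in> M" "(\<lambda>n. f n + g n) \<longlonglongrightarrow> x + y"
    using subspace_add[OF assms] by (auto intro: tendsto_add)
  then show "x + y \<in> closure M"
    unfolding closure_sequential by (intro exI[of _ "\<lambda>n. f n + g n"]) simp
next
  fix c :: real and x assume "x \<in> closure M"
  then obtain f where "\<And>n. f n \<in> M" "f \<longlonglongrightarrow> x"
    unfolding closure_sequential by metis
  then have "\<And>n. c *\<^sub>R f n \<in> M" "(\<lambda>n. c *\<^sub>R f n) \<longlonglongrightarrow> c *\<^sub>R x"
    using subspace_scale[OF assms] by (auto intro: tendsto_intros)
  then show "c *\<^sub>R x \<in> closure M"
    unfolding closure_sequential by (intro exI[of _ "\<lambda>n. c *\<^sub>R f n"]) simp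
qed

text \<open>
  The difference between a point outside \<open>M\<close> and the nearest point of \<open>M\<close>. By the parallelogram law
  minimizing sequences are Cauchy.
\<close>

theorem exists_orthogonal_vector:
  fixes M :: "'a::{real_inner, complete_space} set"
  assumes M: "closed M" "subspace M" and "M \<noteq> UNIV"
  shows "\<exists>y. y \<noteq> 0 \<and> (\<forall>x\<in>M. inner x y = 0)"
proof -
  obtain a where a: "a \<notin> M" using assms(3) by blast
  define d where "d = infdist a M"
  have ne: "M \<noteq> {}" using subspace_0[OF M(2)] by blast
  have d0: "0 \<le> d" by (simp add: d_def infdist_nonneg)
  have d_le: "d \<le> norm (a - x)" if "x \<in> M" for x
    using infdist_le[OF that, of a] by (simp add: d_def dist_norm)
  have ex: "\<exists>x\<in>M. norm (a - x) < d + inverse (Suc n)" for n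
  proof -
    have "(INF x\<in>M. dist a x) < d + inverse (Suc n)"
      using ne by (simp add: d_def infdist_def del: of_nat_Suc)
    moreover have "bdd_below ((\<lambda>x. dist a x) ` M)"
      by (rule bdd_belowI[of _ 0]) auto
    ultimately show ?thesis
      using ne by (simp add: cINF_less_iff dist_norm)
  qed
  then obtain f where f: "\<And>n. f n \<in> M" "\<And>n. norm (a - f n) < d + inverse (Suc n)"
    by metis
  have fd: "(\<lambda>n. norm (a - f n)) \<longlonglongrightarrow> d"
  proof (rule tendsto_sandwich)
    show "\<forall>\<^sub>F n in sequentially. d \<le> norm (a - f n)" using d_le f by simp
    show "\<forall>\<^sub>F n in sequentially. norm (a - f n) \<le> d + inverse (Suc n)" using f by (simp add: less_imp_le)
    show "(\<lambda>n. d + inverse (real (Suc n))) \<longlonglongrightarrow> d"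
      using tendsto_add[OF tendsto_const LIMSEQ_inverse_real_of_nat, of d] by simp
  qed simp
  have par: "(norm (f m - f n))\<^sup>2 \<le> 2 * ((norm (a - f m))\<^sup>2 - d\<^sup>2) + 2 * ((norm (a - f n))\<^sup>2 - d\<^sup>2)" for m n
  proof -
    have "(1/2) *\<^sub>R (f m + f n) \<in> M"
      by (intro subspace_scale subspace_add M f)
    then have "d \<le> norm (a - (1/2) *\<^sub>R (f m + f n))" by (rule d_le)
    then have "d\<^sup>2 \<le> (norm (a - (1/2) *\<^sub>R (f m + f n)))\<^sup>2"
      using d0 by (intro power_mono)
    moreover have "(norm (f m - f n))\<^sup>2 + 4 * (norm (a - (1/2) *\<^sub>R (f m + f n)))\<^sup>2
        = 2 * (norm (a - f m))\<^sup>2 + 2 * (norm (a - f n))\<^sup>2"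
      unfolding power2_norm_eq_inner
      by (simp add: inner_diff_left inner_diff_right inner_add_left inner_add_right inner_commute
          add_divide_distrib)
    moreover have "q \<le> 2 * (u - e) + 2 * (v - e)" if "e \<le> s" "q + 4 * s = 2 * u + 2 * v" for q u v s e :: real
      using that by simp
    ultimately show ?thesis by blast
  qed
  have "Cauchy f"
  proof (rule metric_CauchyI)
    fix e :: real assume e: "e > 0"
    have "(\<lambda>n. (norm (a - f n))\<^sup>2 - d\<^sup>2) \<longlonglongrightarrow> d\<^sup>2 - d\<^sup>2"
      by (intro tendsto_intros fd)
    then have "eventually (\<lambda>n. (norm (a - f n))\<^sup>2 - d\<^sup>2 < e\<^sup>2 / 4) sequentially"
      using e by (intro order_tendstoD(2)) auto
    then obtain N where N: "\<And>n. n \<ge> N \<Longrightarrow> (norm (a - f n))\<^sup>2 - d\<^sup>2 < e\<^sup>2 / 4"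
      by (auto simp: eventually_sequentially)
    have "dist (f m) (f n) < e" if "m \<ge> N" "n \<ge> N" for m n
    proof -
      have "(norm (f m - f n))\<^sup>2 < e\<^sup>2"
      proof -
        have "q < c" if "q \<le> 2 * u + 2 * v" "u < c / 4" "v < c / 4" for q u v c :: real
          using that by simp
        then show ?thesis
          using par[of m n] N[OF that(1)] N[OF that(2)] by blast
      qed
      then show ?thesis
        using e by (simp add: dist_norm power2_less_imp_less)
    qed
    then show "\<exists>N. \<forall>m\<ge>N. \<forall>n\<ge>N. dist (f m) (f n) < e" by blast
  qed
  then obtain p where p: "f \<longlonglongrightarrow> p"
    using Cauchy_convergent_iff convergent_def by blast
  have pM: "p \<in> M"
    using closed_sequentially[OF M(1) f(1) p] .
  define y where "y = a - p"
  have "(\<lambda>n. norm (a - f n)) \<longlonglongrightarrow> norm y"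
    unfolding y_def by (intro tendsto_intros p)
  then have ny: "norm y = d"
    using fd LIMSEQ_unique by blast
  have "inner x y = 0" if x: "x \<in> M" for x
  proof (cases "x = 0")
    case False
    \<comment> \<open>The coefficient that minimizes the distance of \<open>y\<close> from the line through \<open>x\<close>.\<close>
    define t where "t = inner x y / inner x x"
    have xx: "inner x x > 0" using False by simp
    have "p + t *\<^sub>R x \<in> M"
      by (intro subspace_add subspace_scale M pM x)
    then have "d \<le> norm (y - t *\<^sub>R x)"
      using d_le[of "p + t *\<^sub>R x"] by (simp add: y_def diff_diff_eq)
    then have "d\<^sup>2 \<le> (norm (y - t *\<^sub>R x))\<^sup>2"
      using d0 by (intro power_mono)
    also have "\<dots> = d\<^sup>2 - 2 * t * inner x y + t * (t * inner x x)"
      unfolding ny[symmetric] power2_norm_eq_inner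
      by (simp add: inner_diff_left inner_diff_right inner_commute algebra_simps)
    also have "t * inner x x = inner x y"
      using xx by (simp add: t_def)
    finally have "t * inner x y \<le> 0" by (simp add: algebra_simps)
    then have "(inner x y)\<^sup>2 \<le> 0"
      using xx by (simp add: t_def power2_eq_square divide_le_0_iff)
    then show ?thesis by simp
  qed simp
  moreover have "y \<noteq> 0" using a pM by (auto simp: y_def)
  ultimately show ?thesis by blast
qed

text \<open>
  If the first components of points of \<open>G\<close> converge, then so do the second ones, by isometry and
  completeness.
\<close>

lemma closed_fst_image_isometric:
  fixes G :: "('a::banach \<times> 'b::banach) set"
  assumes G: "closed G" "subspace G" and iso: "\<And>x. x \<in> G \<Longrightarrow> norm (fst x) = norm (snd x)"
  shows "closed (fst ` G)"
  unfolding closed_sequential_limits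
proof (intro allI impI, elim conjE)
  fix x l assume x: "\<forall>n. x n \<in> fst ` G" and l: "x \<longlonglongrightarrow> l"
  have "\<exists>v. v \<in> G \<and> x n = fst v" for n
    using x by blast
  then obtain g where g: "\<And>n. g n \<in> G" "\<And>n. x n = fst (g n)"
    by metis
  have "norm (snd (g m) - snd (g n)) = norm (x m - x n)" for m n
    using iso[OF subspace_diff[OF G(2) g(1) g(1)], of m n] by (simp add: g(2))
  moreover have "Cauchy x"
    using l LIMSEQ_imp_Cauchy by blast
  ultimately have "Cauchy (\<lambda>n. snd (g n))"
    unfolding Cauchy_def dist_norm by presburger
  then obtain b where b: "(\<lambda>n. snd (g n)) \<longlonglongrightarrow> b"
    using Cauchy_convergent_iff convergent_def by blast
  have "(x n, snd (g n)) = g n" for n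
    unfolding g(2) by (rule prod.collapse)
  then have "g \<longlonglongrightarrow> (l, b)"
    using tendsto_Pair[OF l b] by presburger
  then have "(l, b) \<in> G"
    by (rule closed_sequentially[OF G(1) g(1)])
  then show "l \<in> fst ` G" by (rule rev_image_eqI) (rule fst_conv[symmetric])
qed

text \<open>
  The unitary operator is constructed through its graph, the closed right linear span \<open>G\<close> of \<open>S\<close>:
  equality of inner products extends from \<open>S\<close> to \<open>G\<close> and makes \<open>G\<close> the graph of an isometry in both
  directions, totality makes its domain and range everything, and invariance of \<open>S\<close> under
  \<open>T1 \<times> T2\<close> becomes the intertwining relation.
\<close>

theorem q_unitarily_equivalent_if_equal_inner:
  fixes S :: "('a::separable_quat_hilbert \<times> 'a) set"
  assumes inner: "\<And>a b a' b'. (a, b) \<in> S \<Longrightarrow> (a', b') \<in> S \<Longrightarrow> qinner a a' = qinner b b'"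
    and total1: "\<And>y. (\<And>a b. (a, b) \<in> S \<Longrightarrow> qinner a y = 0) \<Longrightarrow> y = 0"
    and total2: "\<And>y. (\<And>a b. (a, b) \<in> S \<Longrightarrow> qinner b y = 0) \<Longrightarrow> y = 0"
    and T: "T1 \<in> L_r" "T2 \<in> L_r" "\<And>a b. (a, b) \<in> S \<Longrightarrow> (T1 a, T2 b) \<in> S"
  shows "q_unitarily_equivalent T1 T2"
proof -
  define S' where "S' = {(a *\<^sub>Q p, b *\<^sub>Q p) | a b p. (a, b) \<in> S}"
  define G where "G = closure (span S')"
  have sub: "subspace G"
    unfolding G_def by (rule subspace_closure[OF subspace_span])
  have clo: "closed G" by (simp add: G_def)
  have S'G: "(a *\<^sub>Q p, b *\<^sub>Q p) \<in> G" if "(a, b) \<in> S" for a b p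
    unfolding G_def by (rule subsetD[OF closure_subset], rule span_base) (use that S'_def in blast)
  have invariant: "L x \<in> G" if L: "bounded_linear L" and LS: "\<And>v. v \<in> S' \<Longrightarrow> L v \<in> S'" and x: "x \<in> G" for L x
  proof -
    have "L ` span S' = span (L ` S')"
      using linear_span_image[OF bounded_linear.linear[OF L]] by simp
    also have "\<dots> \<subseteq> span S'"
      by (rule span_mono) (use LS in blast)
    also have "\<dots> \<subseteq> G"
      unfolding G_def by (rule closure_subset)
    finally have "L ` closure (span S') \<subseteq> G"
      by (intro image_closure_subset clo linear_continuous_on L)
    then show ?thesis using x unfolding G_def by blast
  qed
  have scale: "(a *\<^sub>Q p, b *\<^sub>Q p) \<in> G" if "(a, b) \<in> G" for a b p
  proof -
    have "bounded_linear (\<lambda>v::'a \<times> 'a. (fst v *\<^sub>Q p, snd v *\<^sub>Q p))"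
      by (intro bounded_linear_Pair bounded_linear_compose[OF scaleQ.bounded_linear_left]
          bounded_linear_fst bounded_linear_snd)
    then have "(\<lambda>v. (fst v *\<^sub>Q p, snd v *\<^sub>Q p)) (a, b) \<in> G"
    proof (rule invariant[OF _ _ that])
      fix v assume "v \<in> S'"
      then obtain a b q where v: "v = (a *\<^sub>Q q, b *\<^sub>Q q)" "(a, b) \<in> S"
        unfolding S'_def by blast
      have "(fst v *\<^sub>Q p, snd v *\<^sub>Q p) = (a *\<^sub>Q (q * p), b *\<^sub>Q (q * p))"
        unfolding v(1) by (simp add: scaleQ_scaleQ)
      then show "(fst v *\<^sub>Q p, snd v *\<^sub>Q p) \<in> S'"
        using v(2) unfolding S'_def by blast
    qed
    then show ?thesis by simp
  qed
  have intertwine: "(T1 a, T2 b) \<in> G" if "(a, b) \<in> G" for a b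
  proof -
    have "bounded_linear (\<lambda>v. (T1 (fst v), T2 (snd v)))"
      using T(1,2) unfolding L_r_def
      by (intro bounded_linear_Pair bounded_linear_compose[OF _ bounded_linear_fst]
          bounded_linear_compose[OF _ bounded_linear_snd]) simp_all
    then have "(\<lambda>v. (T1 (fst v), T2 (snd v))) (a, b) \<in> G"
    proof (rule invariant[OF _ _ that])
      fix v assume "v \<in> S'"
      then obtain a b q where v: "v = (a *\<^sub>Q q, b *\<^sub>Q q)" "(a, b) \<in> S"
        unfolding S'_def by blast
      have "(T1 (fst v), T2 (snd v)) = (T1 a *\<^sub>Q q, T2 b *\<^sub>Q q)"
        unfolding v(1) by (simp add: L_r_simps(6)[OF T(1)] L_r_simps(6)[OF T(2)])
      then show "(T1 (fst v), T2 (snd v)) \<in> S'"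
        using T(3)[OF v(2)] unfolding S'_def by blast
    qed
    then show ?thesis by simp
  qed
  \<comment> \<open>The form \<open>\<beta>\<close> measures the failure of isometry; it vanishes on \<open>S'\<close>, and being bilinear also on
    its span.\<close>
  have iso: "norm (fst x) = norm (snd x)" if "x \<in> G" for x
  proof -
    define \<beta> where "\<beta> x y = inner (fst x) (fst y) - inner (snd x) (snd y)" for x y :: "'a \<times> 'a"
    have lin: "\<beta> 0 y = 0" "\<beta> (c *\<^sub>R x + x') y = c * \<beta> x y + \<beta> x' y" "\<beta> x y = \<beta> y x" for c x x' y
      by (simp_all add: \<beta>_def inner_add_left inner_commute algebra_simps)
    have base: "\<beta> x y = 0" if "x \<in> S'" "y \<in> S'" for x y
    proof -
      obtain a b p where x: "x = (a *\<^sub>Q p, b *\<^sub>Q p)" "(a, b) \<in> S" using \<open>x \<in> S'\<close> S'_def by blast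
      obtain a' b' p' where y: "y = (a' *\<^sub>Q p', b' *\<^sub>Q p')" "(a', b') \<in> S" using \<open>y \<in> S'\<close> S'_def by blast
      show ?thesis
        unfolding \<beta>_def x(1) y(1) fst_conv snd_conv inner_scaleQ_left qinner_scaleQ_right
          inner[OF x(2) y(2)] by (rule diff_self)
    qed
    have half: "\<beta> x y = 0" if x: "x \<in> span S'" and y: "y \<in> S'" for x y
      using x by (induction rule: span_induct_alt) (simp_all add: lin(1,2) base y)
    have "\<beta> x y = 0" if x: "x \<in> span S'" and y: "y \<in> span S'" for x y
      using x
    proof (induction rule: span_induct_alt)
      case (step c v w)
      have "\<beta> v y = 0"
        using half[OF y step.hyps(1)] lin(3)[of v y] by simp
      then show ?case
        using step by (simp add: lin(2))
    qed (rule lin(1))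
    then have "span S' \<subseteq> {x. norm (fst x) = norm (snd x)}"
      by (auto simp: \<beta>_def norm_eq_sqrt_inner)
    then have "G \<subseteq> {x. norm (fst x) = norm (snd x)}"
      unfolding G_def by (rule closure_minimal) (intro closed_Collect_eq continuous_intros)
    then show ?thesis using that by blast
  qed
  have iso_inner: "inner a a' = inner b b'" if "(a, b) \<in> G" "(a', b') \<in> G" for a b a' b'
    using iso[OF that(1)] iso[OF that(2)] iso[OF subspace_add[OF sub that]]
    by (simp add: dot_norm)
  have UNIVI: "M = UNIV" if "closed M" "subspace M" "\<And>y. (\<And>x. x \<in> M \<Longrightarrow> inner x y = 0) \<Longrightarrow> y = 0"
    for M :: "'a set"
    using exists_orthogonal_vector[OF that(1,2)] that(3) by blast
  have surj1: "fst ` G = UNIV"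
  proof (rule UNIVI)
    show "closed (fst ` G)" by (rule closed_fst_image_isometric[OF clo sub iso])
    show "subspace (fst ` G)" by (rule linear_subspace_image[OF linear_fst sub])
    fix y assume y: "\<And>x. x \<in> fst ` G \<Longrightarrow> inner x y = 0"
    show "y = 0"
    proof (rule total1)
      fix a b assume "(a, b) \<in> S"
      then have "a *\<^sub>Q p \<in> fst ` G" for p
        using imageI[OF S'G, of a b fst p] by simp
      then show "qinner a y = 0"
        using y qinner_zero_if_inner_zero by blast
    qed
  qed
  have surj2: "snd ` G = UNIV"
  proof (rule UNIVI)
    define G' where "G' = prod.swap ` G"
    have eq: "snd ` G = fst ` G'"
      unfolding G'_def image_image by simp
    have lin: "linear (prod.swap :: 'a \<times> 'a \<Rightarrow> 'a \<times> 'a)"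
      by (rule linearI) (simp_all add: prod.swap_def)
    have "prod.swap ` G = prod.swap -` G"
      by (auto intro: rev_image_eqI)
    then have "closed G'"
      unfolding G'_def by (simp only:) (intro closed_vimage clo continuous_on_swap)
    moreover have "subspace G'"
      unfolding G'_def by (rule linear_subspace_image[OF lin sub])
    moreover have "norm (fst x) = norm (snd x)" if "x \<in> G'" for x
      using iso that unfolding G'_def by auto
    ultimately show "closed (snd ` G)"
      unfolding eq by (rule closed_fst_image_isometric)
    show "subspace (snd ` G)" by (rule linear_subspace_image[OF linear_snd sub])
    fix y assume y: "\<And>x. x \<in> snd ` G \<Longrightarrow> inner x y = 0"
    show "y = 0"
    proof (rule total2)
      fix a b assume "(a, b) \<in> S"
      then have "b *\<^sub>Q p \<in> snd ` G" for p
        using imageI[OF S'G, of a b snd p] by simp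
      then show "qinner b y = 0"
        using y qinner_zero_if_inner_zero by blast
    qed
  qed
  have "\<forall>a. \<exists>b. (a, b) \<in> G" "\<forall>b. \<exists>a. (a, b) \<in> G"
  proof -
    have "\<exists>b. (a, b) \<in> G" for a
    proof -
      have "a \<in> fst ` G" by (simp only: surj1 UNIV_I)
      then show ?thesis by force
    qed
    moreover have "\<exists>a. (a, b) \<in> G" for b
    proof -
      have "b \<in> snd ` G" by (simp only: surj2 UNIV_I)
      then show ?thesis by force
    qed
    ultimately show "\<forall>a. \<exists>b. (a, b) \<in> G" "\<forall>b. \<exists>a. (a, b) \<in> G" by blast+
  qed
  then obtain U V where U: "\<And>a. (a, U a) \<in> G" and V: "\<And>b. (V b, b) \<in> G"
    by metis
  have U_eq: "U a = b" if "(a, b) \<in> G" for a b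
    using iso[OF subspace_diff[OF sub U[of a] that]] by simp
  have V_eq: "V b = a" if "(a, b) \<in> G" for a b
    using iso[OF subspace_diff[OF sub V[of b] that]] by simp
  have "bounded_linear U"
  proof (rule bounded_linear_intro[where K=1])
    show "U (x + y) = U x + U y" for x y
      using subspace_add[OF sub U[of x] U[of y]] by (intro U_eq) simp
    show "U (r *\<^sub>R x) = r *\<^sub>R U x" for r x
      using subspace_scale[OF sub U[of x], of r] by (intro U_eq) simp
    show "norm (U x) \<le> norm x * 1" for x
      using iso[OF U[of x]] by simp
  qed
  then have UL: "U \<in> L_r"
    using U_eq scale U by (simp add: L_r_def)
  have "bounded_linear V"
  proof (rule bounded_linear_intro[where K=1])
    show "V (x + y) = V x + V y" for x y
      using subspace_add[OF sub V[of x] V[of y]] by (intro V_eq) simp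
    show "V (r *\<^sub>R x) = r *\<^sub>R V x" for r x
      using subspace_scale[OF sub V[of x], of r] by (intro V_eq) simp
    show "norm (V x) \<le> norm x * 1" for x
      using iso[OF V[of x]] by simp
  qed
  then have VL: "V \<in> L_r"
    using V_eq scale V by (simp add: L_r_def)
  have "is_qadjoint U V"
    unfolding is_qadjoint_def
  proof (intro allI qinner_eq_if_inner_eq)
    show "inner (U x *\<^sub>Q p) y = inner (x *\<^sub>Q p) (V y)" for x y p
      using iso_inner[OF scale[OF U] V] by simp
  qed
  moreover have "V \<circ> U = id" "U \<circ> V = id"
    using U_eq V_eq U V by (auto simp: fun_eq_iff)
  moreover have "U \<circ> T1 = T2 \<circ> U"
    using U_eq[OF intertwine[OF U]] by (simp add: fun_eq_iff)
  ultimately show ?thesis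
    unfolding q_unitarily_equivalent_def using UL VL by blast
qed

section \<open>The base of the bundle\<close>

lemma S_op_eq_if_qsim: "qsim p q \<Longrightarrow> S_op T p = S_op T q"
  by (simp add: qsim_def S_op_def)

lemma norm_qIm: "(norm (qIm p))\<^sup>2 = (qI p)\<^sup>2 + (qJ p)\<^sup>2 + (qK p)\<^sup>2"
  unfolding norm_quat_power2 by simp

text \<open>
  \<open>S_op\<close> only depends on the similarity class of the quaternion, so the fibre over the
  reduced point is the kernel at each quaternion in the class.
\<close>

lemma qsim_qred: "qsim (quat_of_complex (qred p)) p"
proof -
  have "(norm (quat_of_complex (qred p)))\<^sup>2 = (norm p)\<^sup>2"
    unfolding norm_quat_power2 by (simp add: qred_def norm_qIm)
  then show ?thesis
    by (simp add: qsim_def qred_def)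
qed

lemma qred_quat_of_complex:
  assumes "Im z \<ge> 0"
  shows "qred (quat_of_complex z) = z"
proof -
  have "(norm (qIm (quat_of_complex z)))\<^sup>2 = (Im z)\<^sup>2"
    unfolding norm_qIm by simp
  then have "norm (qIm (quat_of_complex z)) = Im z"
    using assms by (simp add: power2_eq_iff_nonneg)
  then show ?thesis
    by (simp add: qred_def complex_eq_iff)
qed

lemma continuous_on_qred: "continuous_on A qred"
proof -
  have re: "qRe = (\<lambda>p. inner p 1)" and im: "qIm = (\<lambda>p. p - of_real (inner p 1))"
    by (auto simp: fun_eq_iff inner_quat_def quat_eq_iff)
  show ?thesis
    unfolding qred_def [abs_def] re im by (intro continuous_intros)
qed

lemma
  assumes sym: "axially_symmetric \<Omega>" and real: "\<Omega> \<inter> \<real> = {}" and z: "z \<in> qred ` \<Omega>"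
  shows quat_of_complex_in_base: "quat_of_complex z \<in> \<Omega>" and base_Im_pos: "Im z > 0"
proof -
  obtain p where p: "p \<in> \<Omega>" "z = qred p" using z by blast
  show "quat_of_complex z \<in> \<Omega>"
    using sym p qsim_qred unfolding axially_symmetric_def by blast
  have "qIm p \<noteq> 0"
  proof
    assume "qIm p = 0"
    then have "p = of_real (qRe p)" by (simp add: quat_eq_iff)
    then have "p \<in> \<real>" by (metis Reals_of_real)
    then show False using real p by blast
  qed
  then show "Im z > 0" by (simp add: p qred_def)
qed

lemma open_base:
  assumes "axially_symmetric \<Omega>" and "\<Omega> \<inter> \<real> = {}" and "open \<Omega>"
  shows "open (qred ` \<Omega>)"
proof -
  have "qred ` \<Omega> = {z. Im z > 0} \<inter> quat_of_complex -` \<Omega>" (is "_ = ?R")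
  proof
    show "qred ` \<Omega> \<subseteq> ?R"
      using quat_of_complex_in_base[OF assms(1,2)] base_Im_pos[OF assms(1,2)] by blast
    show "?R \<subseteq> qred ` \<Omega>"
      using qred_quat_of_complex by (force intro: rev_image_eqI)
  qed
  moreover have "open ?R"
    by (intro open_Int open_vimage assms open_halfspace_Im_gt
        linear_continuous_on bounded_linear_quat_of_complex)
  ultimately show ?thesis by simp
qed

section \<open>Holomorphic sections of the bundle\<close>

lemma holomorphic_section_iff:
  "holomorphic_section (qred ` \<Omega>) (E_bundle \<Omega> T) \<Delta> g \<longleftrightarrow>
     open \<Delta> \<and> \<Delta> \<subseteq> qred ` \<Omega> \<and> right_holomorphic_on g \<Delta> \<and>
     (\<forall>w\<in>\<Delta>. g w \<in> op_ker (S_op T (quat_of_complex w)))"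
  unfolding holomorphic_section_def fibre_def E_bundle_def by auto

lemma holomorphic_section_mono:
  "holomorphic_section B E \<Delta> g \<Longrightarrow> open \<Delta>' \<Longrightarrow> \<Delta>' \<subseteq> \<Delta> \<Longrightarrow> holomorphic_section B E \<Delta>' g"
  unfolding holomorphic_section_def using right_holomorphic_on_subset by blast

text \<open>
  The radius \<open>2 r\<close> is the same for all centres \<open>z\<close> near \<open>z0\<close>. So the disc of a section through a
  vector over any \<open>z\<close> within \<open>r\<close> of \<open>z0\<close> reaches all points of \<open>ball z0 r\<close>, in particular \<open>z0\<close>.
\<close>

lemma eigenspace_sections_exist_locally:
  fixes T :: "'a::separable_quat_hilbert \<Rightarrow> 'a"
  assumes T: "T \<in> L_r" and B: "open B" "z0 \<in> B" and surj: "range (S_op T (quat_of_complex z0)) = UNIV"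
  shows "\<exists>r>0. \<forall>z\<in>ball z0 r. ball z (2 * r) \<subseteq> B \<and>
     (\<forall>x\<in>eigenspace T z. \<exists>g. right_holomorphic_on g (ball z (2 * r)) \<and> g z = x \<and>
        (\<forall>w\<in>ball z (2 * r). g w \<in> eigenspace T w))"
proof -
  obtain C e where C: "C > 0" and e: "e > 0"
    and pre: "\<And>w y. w \<in> ball z0 e \<Longrightarrow> \<exists>x. T x - x *\<^sub>Q quat_of_complex w = y \<and> norm x \<le> C * norm y"
    using locally_uniform_bounded_preimage[OF T surj] by blast
  obtain d where d: "d > 0" "ball z0 d \<subseteq> B"
    using B open_contains_ball by blast
  \<comment> \<open>Three conditions: the bound \<open>C\<close> is valid at \<open>z\<close>; \<open>ball z (2 * r)\<close> stays in \<open>ball z0 (3 * r)\<close> and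
    hence in \<open>B\<close>; the power series converges on it.\<close>
  define r where "r = min e (min (d / 3) (1 / (4 * C)))"
  have "r \<le> e" "r \<le> d / 3" "r \<le> 1 / (4 * C)"
    by (simp_all add: r_def min_le_iff_disj)
  moreover have "r > 0"
    using e d(1) C by (simp add: r_def)
  ultimately have r: "r > 0" "r \<le> e" "3 * r \<le> d" "2 * r \<le> 1 / (2 * C)"
    using C by (simp_all add: field_simps)
  show ?thesis
  proof (intro exI[of _ r] conjI ballI r(1))
    fix z assume z: "z \<in> ball z0 r"
    have "ball z (2 * r) \<subseteq> ball z0 d"
    proof
      fix w assume "w \<in> ball z (2 * r)"
      then show "w \<in> ball z0 d"
        using z r(3) dist_triangle[of z0 w z] by simp
    qed
    then show "ball z (2 * r) \<subseteq> B" using d by blast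
    fix x assume x: "x \<in> eigenspace T z"
    have "z \<in> ball z0 e" using z r by simp
    then obtain g where g: "right_holomorphic_on g (ball z (1 / (2 * C)))" "g z = x"
        "\<forall>w\<in>ball z (1 / (2 * C)). g w \<in> eigenspace T w"
      using eigenspace_section_through[OF T C pre x] by blast
    have "ball z (2 * r) \<subseteq> ball z (1 / (2 * C))"
      using r(4) by (rule subset_ball)
    then show "\<exists>g. right_holomorphic_on g (ball z (2 * r)) \<and> g z = x \<and> (\<forall>w\<in>ball z (2 * r). g w \<in> eigenspace T w)"
      using g right_holomorphic_on_subset by blast
  qed
qed

text \<open>
  For an operator in \<open>L_r\<close> these are exactly the holomorphic sections of its bundle.
\<close>

definition eigensection :: "('a::quat_inner \<Rightarrow> 'a) \<Rightarrow> complex set \<Rightarrow> complex set \<Rightarrow> (complex \<Rightarrow> 'a) \<Rightarrow> bool" where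
  "eigensection T B \<Delta> g \<longleftrightarrow> open \<Delta> \<and> \<Delta> \<subseteq> B \<and> right_holomorphic_on g \<Delta> \<and> (\<forall>w\<in>\<Delta>. g w \<in> eigenspace T w)"

lemma holomorphic_section_iff_eigensection:
  fixes T :: "'a::separable_quat_hilbert \<Rightarrow> 'a"
  assumes "T \<in> L_r"
  shows "holomorphic_section (qred ` \<Omega>) (E_bundle \<Omega> T) \<Delta> g \<longleftrightarrow> eigensection T (qred ` \<Omega>) \<Delta> g"
  unfolding holomorphic_section_iff eigensection_def
  using right_holomorphic_op_ker_imp_eigenspace[OF assms] eigenspace_subset_op_ker[OF assms] by blast

text \<open>
  The identity theorem for the bundle. It is applied with the identity and with a bundle map as
  \<open>\<Psi>\<close>. On every disc that carries a section, vanishing of all derivatives at \<open>z0\<close> forces vanishing; as there are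
  sections through all eigenvectors on discs of locally constant size, the set of points near which
  the functional vanishes is both open and closed in \<open>B\<close>.
\<close>

proposition eigensection_uniqueness:
  fixes T :: "'a::separable_quat_hilbert \<Rightarrow> 'a" and \<Psi> :: "complex \<Rightarrow> 'a \<Rightarrow> 'a"
  assumes T: "T \<in> L_r" and B: "open B" "connected B" "z0 \<in> B"
    and surj: "\<And>z. z \<in> B \<Longrightarrow> range (S_op T (quat_of_complex z)) = UNIV"
    and \<Psi>: "\<And>\<Delta> g. eigensection T B \<Delta> g \<Longrightarrow> right_holomorphic_on (\<lambda>w. \<Psi> w (g w)) \<Delta>"
    and zero: "\<And>\<Delta> g m. eigensection T B \<Delta> g \<Longrightarrow> z0 \<in> \<Delta> \<Longrightarrow>
      cpairing y ((right_deriv ^^ m) (\<lambda>w. \<Psi> w (g w)) z0) = 0"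
    and z: "z \<in> B" and x: "x \<in> eigenspace T z"
  shows "cpairing y (\<Psi> z x) = 0"
proof -
  define van where "van z \<longleftrightarrow> (\<exists>d>0. \<forall>w\<in>ball z d. \<forall>x\<in>eigenspace T w. cpairing y (\<Psi> w x) = 0)" for z
  have sec: "\<exists>r>0. \<forall>z\<in>ball z1 r. \<forall>x\<in>eigenspace T z. \<exists>g. eigensection T B (ball z (2 * r)) g \<and> g z = x"
    if "z1 \<in> B" for z1
    using eigenspace_sections_exist_locally[OF T B(1) that surj[OF that]]
    unfolding eigensection_def by (meson open_ball)
  have hol: "(\<lambda>w. cpairing y (\<Psi> w (g w))) holomorphic_on \<Delta>" if "eigensection T B \<Delta> g" for \<Delta> g
    using cpairing_holomorphic[OF \<Psi>[OF that]] that by (simp add: eigensection_def)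
  have "van z0"
  proof -
    obtain r where r: "r > 0" and rs: "\<And>z x. z \<in> ball z0 r \<Longrightarrow> x \<in> eigenspace T z \<Longrightarrow>
        \<exists>g. eigensection T B (ball z (2 * r)) g \<and> g z = x"
      using sec[OF B(3)] by blast
    have "cpairing y (\<Psi> z x) = 0" if zx: "z \<in> ball z0 r" "x \<in> eigenspace T z" for z x
    proof -
      obtain g where g: "eigensection T B (ball z (2 * r)) g" "g z = x" using rs[OF zx] by blast
      have z0: "z0 \<in> ball z (2 * r)" using zx(1) r by (simp add: dist_commute)
      have "cpairing y (\<Psi> z (g z)) = 0"
      proof (rule holomorphic_fun_eq_0_on_connected[OF hol[OF g(1)] open_ball connected_ball _ z0])
        show "(deriv ^^ n) (\<lambda>w. cpairing y (\<Psi> w (g w))) z0 = 0" for n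
          using cpairing_higher_right_deriv[OF \<Psi>[OF g(1)] open_ball z0, of y n] zero[OF g(1) z0, of n] by simp
        show "z \<in> ball z (2 * r)" using r by simp
      qed
      then show ?thesis using g(2) by simp
    qed
    then show ?thesis unfolding van_def using r by blast
  qed
  moreover have "van z0 = van z"
  proof (rule connected_local_const[OF B(2,3) z, rule_format])
    fix a assume a: "a \<in> B"
    obtain r where r: "r > 0" and rs: "\<And>z x. z \<in> ball a r \<Longrightarrow> x \<in> eigenspace T z \<Longrightarrow>
        \<exists>g. eigensection T B (ball z (2 * r)) g \<and> g z = x"
      using sec[OF a] by blast
    have spread: "cpairing y (\<Psi> w x) = 0"
      if b: "b \<in> ball a r" "van b" and w: "w \<in> ball a r" and x: "x \<in> eigenspace T w" for b w x
    proof -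
      obtain g where g: "eigensection T B (ball w (2 * r)) g" "g w = x" using rs[OF w x] by blast
      obtain d where d: "d > 0" "\<And>v x. v \<in> ball b d \<Longrightarrow> x \<in> eigenspace T v \<Longrightarrow> cpairing y (\<Psi> v x) = 0"
        using b(2) unfolding van_def by blast
      have bw: "b \<in> ball w (2 * r)"
        using b(1) w dist_triangle[of w b a] by (simp add: dist_commute)
      have "cpairing y (\<Psi> w (g w)) = 0"
      proof (rule analytic_continuation_open[where s="ball b d \<inter> ball w (2 * r)" and s'="ball w (2 * r)"
            and f="\<lambda>w. cpairing y (\<Psi> w (g w))" and g="\<lambda>_. 0"])
        have "b \<in> ball b d" using d(1) by simp
        then show "ball b d \<inter> ball w (2 * r) \<noteq> {}" using bw by blast
        show "(\<lambda>w. cpairing y (\<Psi> w (g w))) holomorphic_on ball w (2 * r)" by (rule hol[OF g(1)])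
        show "cpairing y (\<Psi> v (g v)) = 0" if "v \<in> ball b d \<inter> ball w (2 * r)" for v
          using that g(1) d(2) unfolding eigensection_def by blast
      qed (use r in auto)
      then show ?thesis using g(2) by simp
    qed
    have sub: "\<exists>d>0. ball b d \<subseteq> ball a r" if "b \<in> ball a r" for b
      using that open_contains_ball[of "ball a r"] open_ball by blast
    have "van a = van b" if b: "b \<in> ball a r" for b
    proof -
      have a': "a \<in> ball a r" using r by simp
      have "van c" if "van b'" "b' \<in> ball a r" "c \<in> ball a r" for b' c
        using sub[OF that(3)] spread[OF that(2,1)] unfolding van_def by (meson subsetD)
      then show ?thesis using a' b by blast
    qed
    then show "eventually (\<lambda>b. van a = van b) (at a within B)"
      using r unfolding eventually_at by (intro exI[of _ r]) (auto simp: dist_commute)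
  qed
  ultimately have "van z" by simp
  then obtain d where "d > 0" "\<forall>w\<in>ball z d. \<forall>x\<in>eigenspace T w. cpairing y (\<Psi> w x) = 0"
    unfolding van_def by blast
  then show ?thesis
    using x by (metis centre_in_ball)
qed

text \<open>
  A vector orthogonal to all derivatives at a single point is orthogonal to \<open>\<Psi>\<close> of all eigenvectors,
  hence to \<open>\<Psi>\<close> of the kernels, which consist of the eigenvectors and their multiples by \<open>\<^bold>j\<close>.
  These images are the fibres for \<open>T'\<close>, whose span is dense.
\<close>

proposition derivatives_of_eigensections_total:
  fixes T T' :: "'a::separable_quat_hilbert \<Rightarrow> 'a" and \<Psi> :: "complex \<Rightarrow> 'a \<Rightarrow> 'a"
  defines "K \<equiv> \<lambda>T z. op_ker (S_op T (quat_of_complex z))"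
  assumes T: "T \<in> L_r" and B: "open B" "connected B" "z0 \<in> B" and im: "\<And>z. z \<in> B \<Longrightarrow> Im z \<noteq> 0"
    and surj: "\<And>z. z \<in> B \<Longrightarrow> range (S_op T (quat_of_complex z)) = UNIV"
    and \<Psi>: "\<And>\<Delta> g. eigensection T B \<Delta> g \<Longrightarrow> right_holomorphic_on (\<lambda>w. \<Psi> w (g w)) \<Delta>"
    and \<Psi>_iso: "\<And>z. z \<in> B \<Longrightarrow> right_linear_iso (K T z) (K T' z) (\<Psi> z)"
    and dense: "closure (qspan (\<Union>z\<in>B. K T' z)) = UNIV" and T': "T' \<in> L_r"
    and zero: "\<And>\<Delta> g m. eigensection T B \<Delta> g \<Longrightarrow> z0 \<in> \<Delta> \<Longrightarrow>
      qinner ((right_deriv ^^ m) (\<lambda>w. \<Psi> w (g w)) z0) y = 0"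
  shows "y = 0"
proof -
  have eig: "inner (\<Psi> z u) (y *\<^sub>Q q) = 0" if z: "z \<in> B" and u: "u \<in> eigenspace T z" for z u q
  proof -
    have "cpairing (y *\<^sub>Q q) (\<Psi> z u) = 0"
    proof (rule eigensection_uniqueness[OF T B surj \<Psi> _ z u])
      fix \<Delta> g m assume "eigensection T B \<Delta> g" "z0 \<in> \<Delta>"
      then show "cpairing (y *\<^sub>Q q) ((right_deriv ^^ m) (\<lambda>w. \<Psi> w (g w)) z0) = 0"
        using zero by (simp add: cpairing_zero_iff qinner_scaleQ_left qinner_scaleQ_right flip: qRe_qinner)
    qed
    then show ?thesis by (simp add: cpairing_zero_iff)
  qed
  have ker: "inner v y = 0" if z: "z \<in> B" and v: "v \<in> K T' z" for z v
  proof -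
    note iso = \<Psi>_iso[OF z, unfolded right_linear_iso_def]
    obtain x where x: "x \<in> K T z" "v = \<Psi> z x"
      using iso v unfolding bij_betw_def by blast
    obtain a b where ab: "a \<in> eigenspace T z" "b \<in> eigenspace T z" "x = a + b *\<^sub>Q Quat 0 0 1 0"
      using op_ker_decomposition[OF T im[OF z]] x(1) unfolding K_def by blast
    have aK: "a \<in> K T z" and bK: "b \<in> K T z"
      using ab eigenspace_subset_op_ker[OF T] unfolding K_def by blast+
    moreover have "b *\<^sub>Q Quat 0 0 1 0 \<in> K T z"
      using bK by (simp add: K_def op_ker_def L_r_simps[OF S_op_L_r[OF T]])
    ultimately have "v = \<Psi> z a + \<Psi> z b *\<^sub>Q Quat 0 0 1 0"
      using iso unfolding x(2) ab(3) by simp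
    moreover have "inner (\<Psi> z b *\<^sub>Q Quat 0 0 1 0) y = inner (\<Psi> z b) (y *\<^sub>Q qcnj (Quat 0 0 1 0))"
    proof -
      have "qcnj (qcnj (Quat 0 0 1 0)) = Quat 0 0 1 0" by (simp add: quat_eq_iff)
      then show ?thesis by (simp only: inner_scaleQ_right)
    qed
    ultimately show ?thesis
      using eig[OF z ab(1), of 1] eig[OF z ab(2), of "qcnj (Quat 0 0 1 0)"] by (simp add: inner_add_left)
  qed
  have "inner v y = 0" if v: "v \<in> qspan (\<Union>z\<in>B. K T' z)" for v
  proof -
    obtain F c where F: "v = (\<Sum>b\<in>F. b *\<^sub>Q c b)" "F \<subseteq> (\<Union>z\<in>B. K T' z)"
      using v unfolding qspan_def by blast
    have "inner (b *\<^sub>Q c b) y = 0" if "b \<in> F" for b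
    proof -
      obtain z where z: "z \<in> B" "b \<in> K T' z" using F(2) \<open>b \<in> F\<close> by blast
      then have "b *\<^sub>Q c b \<in> K T' z"
        by (simp add: K_def op_ker_def L_r_simps[OF S_op_L_r[OF T']])
      then show ?thesis by (rule ker[OF z(1)])
    qed
    then show ?thesis by (simp add: F(1) inner_sum_left)
  qed
  then have "qspan (\<Union>z\<in>B. K T' z) \<subseteq> {v. inner v y = 0}" by blast
  then have "closure (qspan (\<Union>z\<in>B. K T' z)) \<subseteq> {v. inner v y = 0}"
    by (rule closure_minimal) (intro closed_Collect_eq continuous_intros)
  then have "y \<in> {v. inner v y = 0}" using dense by blast
  then show ?thesis by simp
qed

text \<open>
  Differentiation in the real direction of \<open>\<langle>f\<^sup>(\<^sup>m\<^sup>), g\<^sup>(\<^sup>k\<^sup>)\<rangle>\<close> gives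
  \<open>\<langle>f\<^sup>(\<^sup>m\<^sup>+\<^sup>1\<^sup>), g\<^sup>(\<^sup>k\<^sup>)\<rangle> + \<langle>f\<^sup>(\<^sup>m\<^sup>), g\<^sup>(\<^sup>k\<^sup>+\<^sup>1\<^sup>)\<rangle>\<close>. The first summand is known by induction, so the second
  one is determined. That is why the hypothesis is needed for all \<open>m\<close> at once.
\<close>

proposition qinner_higher_right_deriv_eq:
  fixes f g f' g' :: "complex \<Rightarrow> 'a::separable_quat_hilbert"
  assumes "open \<Delta>" and hol: "right_holomorphic_on f \<Delta>" "right_holomorphic_on g \<Delta>"
      "right_holomorphic_on f' \<Delta>" "right_holomorphic_on g' \<Delta>"
    and eq: "\<And>m z. z \<in> \<Delta> \<Longrightarrow> qinner ((right_deriv ^^ m) f z) (g z) = qinner ((right_deriv ^^ m) f' z) (g' z)"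
  shows "z \<in> \<Delta> \<Longrightarrow> qinner ((right_deriv ^^ m) f z) ((right_deriv ^^ k) g z) =
     qinner ((right_deriv ^^ m) f' z) ((right_deriv ^^ k) g' z)"
proof (induction k arbitrary: m z)
  case (Suc k)
  show ?case
  proof (rule qinner_eq_if_inner_eq)
    fix p
    have deriv: "((\<lambda>w. inner ((right_deriv ^^ m) f w *\<^sub>Q p) ((right_deriv ^^ k) g w)) has_derivative
       (\<lambda>h. inner ((right_deriv ^^ m) f z *\<^sub>Q p) ((right_deriv ^^ Suc k) g z *\<^sub>Q quat_of_complex h)
          + inner ((right_deriv ^^ Suc m) f z *\<^sub>Q quat_of_complex h *\<^sub>Q p) ((right_deriv ^^ k) g z))) (at z)"
      if "right_holomorphic_on f \<Delta>" "right_holomorphic_on g \<Delta>" for f g :: "complex \<Rightarrow> 'a"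
      using has_derivative_inner[OF bounded_linear.has_derivative[OF scaleQ.bounded_linear_left
            has_derivative_right_deriv[OF right_holomorphic_higher_right_deriv[OF that(1) \<open>open \<Delta>\<close>] Suc.prems]]
          has_derivative_right_deriv[OF right_holomorphic_higher_right_deriv[OF that(2) \<open>open \<Delta>\<close>] Suc.prems]]
      by simp
    have same: "inner ((right_deriv ^^ m) f w *\<^sub>Q p) ((right_deriv ^^ k) g w) =
        inner ((right_deriv ^^ m) f' w *\<^sub>Q p) ((right_deriv ^^ k) g' w)" if "w \<in> \<Delta>" for w m
      using Suc.IH[OF that] by (simp only: inner_scaleQ_left)
    note has_derivative_unique[OF has_derivative_transform_within_open[OF deriv[OF hol(1,2)] \<open>open \<Delta>\<close> Suc.prems same]
        deriv[OF hol(3,4)]]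
    from fun_cong[OF this, of 1]
    show "inner ((right_deriv ^^ m) f z *\<^sub>Q p) ((right_deriv ^^ Suc k) g z) =
        inner ((right_deriv ^^ m) f' z *\<^sub>Q p) ((right_deriv ^^ Suc k) g' z)"
      using same[OF Suc.prems, of "Suc m"] by simp
  qed
qed (use eq in auto)

section \<open>Unitary equivalence and equivalence of bundles\<close>

lemma B_sD:
  assumes "T \<in> B_s n \<Omega>"
  shows "T \<in> L_r" "\<omega> \<in> \<Omega> \<Longrightarrow> range (S_op T \<omega>) = UNIV"
    "closure (qspan (\<Union>\<omega>\<in>\<Omega>. op_ker (S_op T \<omega>))) = UNIV"
  using assms unfolding B_s_def by blast+

text \<open>
  A unitary operator that intertwines \<open>T1\<close> and \<open>T2\<close> acts on each fibre, and it commutes with the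
  derivatives because these exist.
\<close>

lemma unitarily_equivalent_imp_bundles_equivalent:
  fixes T1 T2 :: "'a::separable_quat_hilbert \<Rightarrow> 'a"
  assumes T: "T1 \<in> L_r" "T2 \<in> L_r" and eq: "q_unitarily_equivalent T1 T2"
  shows "hermitian_bundles_equivalent (qred ` \<Omega>) (E_bundle \<Omega> T1) (E_bundle \<Omega> T2)"
proof -
  obtain U V where U: "U \<in> L_r" and V: "V \<in> L_r" and adj: "is_qadjoint U V"
    and "V \<circ> U = id" "U \<circ> V = id" "U \<circ> T1 = T2 \<circ> U"
    using eq unfolding q_unitarily_equivalent_def by blast
  then have VU: "V (U x) = x" and UV: "U (V x) = x" and UT: "U (T1 x) = T2 (U x)" for x
    by (simp_all add: fun_eq_iff)
  have U0: "U x = 0 \<longleftrightarrow> x = 0" for x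
  proof
    show "x = 0" if "U x = 0"
      using VU[of x] unfolding that L_r_simps(4)[OF V] by simp
    show "U x = 0" if "x = 0"
      unfolding that by (rule L_r_simps(4)[OF U])
  qed
  have "S_op T2 s (U x) = U (S_op T1 s x)" for s x
    by (simp add: S_op_def L_r_simps[OF U] UT)
  then have ker: "U x \<in> op_ker (S_op T2 s) \<longleftrightarrow> x \<in> op_ker (S_op T1 s)" for s x
    by (simp add: op_ker_def U0)
  have inner: "qinner (U x) (U y) = qinner x y" for x y
    using adj by (simp add: is_qadjoint_def VU)
  define \<Phi> where "\<Phi> = (\<lambda>e::'a \<times> complex. (U (fst e), snd e))"
  have on: "on_fibre \<Phi> \<omega> = U" "on_section \<Phi> g = (\<lambda>w. U (g w))" for \<omega> g
    by (simp_all add: on_fibre_def on_section_def \<Phi>_def fun_eq_iff)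
  have "bounded_linear U" using U by (simp add: L_r_def)
  then have "continuous_on (E_bundle \<Omega> T1) \<Phi>"
    unfolding \<Phi>_def
    by (intro continuous_on_Pair continuous_on_snd continuous_on_id
        bounded_linear.continuous_on[OF _ continuous_on_fst])
  then have bm: "bundle_map (E_bundle \<Omega> T1) (E_bundle \<Omega> T2) \<Phi>"
    unfolding bundle_map_def using ker by (auto simp: \<Phi>_def E_bundle_def)
  have iso: "right_linear_iso (fibre (E_bundle \<Omega> T1) \<omega>) (fibre (E_bundle \<Omega> T2) \<omega>) (on_fibre \<Phi> \<omega>)" for \<omega>
    unfolding right_linear_iso_def on
  proof (intro conjI ballI allI L_r_simps(1,6)[OF U])
    show "bij_betw U (fibre (E_bundle \<Omega> T1) \<omega>) (fibre (E_bundle \<Omega> T2) \<omega>)"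
    proof (rule bij_betw_byWitness[where f'=V])
      have "V x \<in> op_ker (S_op T1 s)" if "x \<in> op_ker (S_op T2 s)" for x s
        using ker[of "V x" s] that by (simp add: UV)
      then show "V ` fibre (E_bundle \<Omega> T2) \<omega> \<subseteq> fibre (E_bundle \<Omega> T1) \<omega>"
        by (auto simp: fibre_def E_bundle_def)
      show "U ` fibre (E_bundle \<Omega> T1) \<omega> \<subseteq> fibre (E_bundle \<Omega> T2) \<omega>"
        using ker by (auto simp: fibre_def E_bundle_def)
    qed (simp_all add: VU UV)
  qed
  have sec: "holomorphic_section (qred ` \<Omega>) (E_bundle \<Omega> T2) \<Delta> (on_section \<Phi> g)"
    if "holomorphic_section (qred ` \<Omega>) (E_bundle \<Omega> T1) \<Delta> g" for \<Delta> g
    using that right_holomorphic_L_r[OF U, of g \<Delta>] unfolding on holomorphic_section_iff by (simp add: ker)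
  have herm: "qinner ((right_deriv ^^ m) g \<omega>) (g' \<omega>) =
      qinner ((right_deriv ^^ m) (on_section \<Phi> g) \<omega>) (on_section \<Phi> g' \<omega>)"
    if "holomorphic_section (qred ` \<Omega>) (E_bundle \<Omega> T1) \<Delta> g" "\<omega> \<in> \<Delta>" for \<Delta> g g' m \<omega>
    using that higher_right_deriv_L_r[OF U, of g \<Delta> \<omega> m]
    unfolding on holomorphic_section_iff by (simp add: inner)
  show ?thesis
    unfolding hermitian_bundles_equivalent_def
    by (intro exI[of _ \<Phi>] conjI allI impI ballI bm iso sec) (auto intro: herm)
qed

text \<open>
  The unitary operator sends \<open>g\<^sup>(\<^sup>m\<^sup>)(z0)\<close> to \<open>(\<Phi> g)\<^sup>(\<^sup>m\<^sup>)(z0)\<close> for all sections \<open>g\<close> near a base point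
  \<open>z0\<close>. For the intertwining relation, \<open>T1 g\<close> is again a section, namely \<open>g(w) w\<close>, and right
  linearity of \<open>\<Phi>\<close> on fibres makes its image \<open>\<Phi>(g)(w) w = T2 (\<Phi> g)(w)\<close>.
\<close>

proposition bundles_equivalent_imp_unitarily_equivalent:
  fixes T1 T2 :: "'a::separable_quat_hilbert \<Rightarrow> 'a"
  assumes \<Omega>: "axially_symmetric \<Omega>" "connected \<Omega>" "open \<Omega>" "\<Omega> \<inter> \<real> = {}" "\<Omega> \<noteq> {}"
    and T1: "T1 \<in> B_s n \<Omega>" and T2: "T2 \<in> B_s n \<Omega>"
    and eq: "hermitian_bundles_equivalent (qred ` \<Omega>) (E_bundle \<Omega> T1) (E_bundle \<Omega> T2)"
  shows "q_unitarily_equivalent T1 T2"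
proof -
  define B where "B = qred ` \<Omega>"
  note L1 = B_sD(1)[OF T1] and L2 = B_sD(1)[OF T2]
  have B: "open B" "connected B"
    unfolding B_def by (rule open_base[OF \<Omega>(1,4,3)], rule connected_continuous_image[OF continuous_on_qred \<Omega>(2)])
  obtain z0 where z0: "z0 \<in> B" using \<Omega>(5) B_def by blast
  have im: "Im z \<noteq> 0" if "z \<in> B" for z
    using base_Im_pos[OF \<Omega>(1,4), of z] that unfolding B_def by simp
  have surj: "range (S_op T (quat_of_complex z)) = UNIV" if "T \<in> B_s n \<Omega>" "z \<in> B" for T :: "'a \<Rightarrow> 'a" and z
    by (rule B_sD(2)[OF that(1) quat_of_complex_in_base[OF \<Omega>(1,4) that(2)[unfolded B_def]]])
  have dense: "closure (qspan (\<Union>z\<in>B. op_ker (S_op T (quat_of_complex z)))) = UNIV"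
    if "T \<in> B_s n \<Omega>" for T :: "'a \<Rightarrow> 'a"
    using B_sD(3)[OF that] unfolding B_def image_image S_op_eq_if_qsim[OF qsim_qred] .
  obtain \<Phi> where \<Phi>:
    "bundle_map (E_bundle \<Omega> T1) (E_bundle \<Omega> T2) \<Phi> \<and>
     (\<forall>\<omega>\<in>B. right_linear_iso (fibre (E_bundle \<Omega> T1) \<omega>) (fibre (E_bundle \<Omega> T2) \<omega>) (on_fibre \<Phi> \<omega>)) \<and>
     (\<forall>\<Delta> g. holomorphic_section B (E_bundle \<Omega> T1) \<Delta> g \<longrightarrow>
        holomorphic_section B (E_bundle \<Omega> T2) \<Delta> (on_section \<Phi> g)) \<and>
     (\<forall>\<Delta> g g'. holomorphic_section B (E_bundle \<Omega> T1) \<Delta> g \<and> holomorphic_section B (E_bundle \<Omega> T1) \<Delta> g' \<longrightarrow>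
        (\<forall>m. \<forall>\<omega>\<in>\<Delta>. qinner ((right_deriv ^^ m) g \<omega>) (g' \<omega>) =
           qinner ((right_deriv ^^ m) (on_section \<Phi> g) \<omega>) (on_section \<Phi> g' \<omega>)))"
    using eq unfolding hermitian_bundles_equivalent_def B_def by (rule exE)
  note iso = \<Phi>[THEN conjunct2, THEN conjunct1, rule_format]
    and sec = \<Phi>[THEN conjunct2, THEN conjunct2, THEN conjunct1, rule_format]
    and herm = \<Phi>[THEN conjunct2, THEN conjunct2, THEN conjunct2, rule_format, OF conjI]
  let ?\<Psi> = "on_fibre \<Phi>"
  note sec1 = holomorphic_section_iff_eigensection[OF L1, of \<Omega>, folded B_def]
  note sec2 = holomorphic_section_iff_eigensection[OF L2, of \<Omega>, folded B_def]
  have fib: "fibre (E_bundle \<Omega> T) z = op_ker (S_op T (quat_of_complex z))" if "z \<in> B" for z and T :: "'a \<Rightarrow> 'a"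
    using that unfolding fibre_def E_bundle_def B_def by simp
  have \<Psi>sec: "eigensection T2 B \<Delta> (on_section \<Phi> g)" if "eigensection T1 B \<Delta> g" for \<Delta> g
    by (rule sec[unfolded sec1 sec2, OF that])
  define S where "S = {((right_deriv ^^ m) g z0, (right_deriv ^^ m) (on_section \<Phi> g) z0) | m g.
      \<exists>\<Delta>. eigensection T1 B \<Delta> g \<and> z0 \<in> \<Delta>}"
  show ?thesis
  proof (rule q_unitarily_equivalent_if_equal_inner[of S, OF _ _ _ L1 L2])
    fix a b a' b' assume "(a, b) \<in> S" "(a', b') \<in> S"
    then obtain m g \<Delta> m' g' \<Delta>' where g: "a = (right_deriv ^^ m) g z0"
        "b = (right_deriv ^^ m) (on_section \<Phi> g) z0" "eigensection T1 B \<Delta> g" "z0 \<in> \<Delta>"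
      and g': "a' = (right_deriv ^^ m') g' z0"
        "b' = (right_deriv ^^ m') (on_section \<Phi> g') z0" "eigensection T1 B \<Delta>' g'" "z0 \<in> \<Delta>'"
      unfolding S_def by blast
    \<comment> \<open>The Hermitian condition compares sections over the same open set.\<close>
    define \<Delta>0 where "\<Delta>0 = \<Delta> \<inter> \<Delta>'"
    have "open \<Delta>0" "z0 \<in> \<Delta>0"
      using g(3,4) g'(3,4) by (auto simp: \<Delta>0_def eigensection_def)
    have s: "holomorphic_section B (E_bundle \<Omega> T1) \<Delta>0 g" "holomorphic_section B (E_bundle \<Omega> T1) \<Delta>0 g'"
      using holomorphic_section_mono[OF g(3)[folded sec1] \<open>open \<Delta>0\<close>]
        holomorphic_section_mono[OF g'(3)[folded sec1] \<open>open \<Delta>0\<close>] by (simp_all add: \<Delta>0_def)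
    have hol: "right_holomorphic_on h \<Delta>0" if "holomorphic_section B E \<Delta>0 h" for E h
      using that by (simp add: holomorphic_section_def)
    show "qinner a a' = qinner b b'"
      unfolding g(1,2) g'(1,2)
      by (rule qinner_higher_right_deriv_eq[OF \<open>open \<Delta>0\<close> hol[OF s(1)] hol[OF s(2)]
            hol[OF sec[OF s(1)]] hol[OF sec[OF s(2)]] herm[OF s] \<open>z0 \<in> \<Delta>0\<close>])
  next
    fix y assume y: "\<And>a b. (a, b) \<in> S \<Longrightarrow> qinner a y = 0"
    show "y = 0"
    proof (rule derivatives_of_eigensections_total[where \<Psi>="\<lambda>_ x. x", OF L1 B z0 im surj[OF T1] _ _ dense[OF T1] L1])
      show "right_linear_iso K K (\<lambda>x. x)" for K :: "'a set"
        by (simp add: right_linear_iso_def bij_betw_def)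
      show "qinner ((right_deriv ^^ m) (\<lambda>w. g w) z0) y = 0" if "eigensection T1 B \<Delta> g" "z0 \<in> \<Delta>" for \<Delta> g m
        by (rule y) (use that S_def in blast)
    qed (simp_all add: eigensection_def)
  next
    fix y assume y: "\<And>a b. (a, b) \<in> S \<Longrightarrow> qinner b y = 0"
    show "y = 0"
    proof (rule derivatives_of_eigensections_total[where \<Psi>="?\<Psi>", OF L1 B z0 im surj[OF T1] _ _ dense[OF T2] L2])
      show "right_holomorphic_on (\<lambda>w. ?\<Psi> w (g w)) \<Delta>" if "eigensection T1 B \<Delta> g" for \<Delta> g
        using \<Psi>sec[OF that] by (simp add: eigensection_def on_section_def)
      show "right_linear_iso (op_ker (S_op T1 (quat_of_complex z))) (op_ker (S_op T2 (quat_of_complex z))) (?\<Psi> z)"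
        if "z \<in> B" for z
        using iso[OF that] unfolding fib[OF that] .
      show "qinner ((right_deriv ^^ m) (\<lambda>w. ?\<Psi> w (g w)) z0) y = 0"
        if "eigensection T1 B \<Delta> g" "z0 \<in> \<Delta>" for \<Delta> g m
        unfolding on_section_def[symmetric] by (rule y) (use that S_def in blast)
    qed
  next
    fix a b assume "(a, b) \<in> S"
    then obtain m g \<Delta> where g: "a = (right_deriv ^^ m) g z0"
        "b = (right_deriv ^^ m) (on_section \<Phi> g) z0" "eigensection T1 B \<Delta> g" "z0 \<in> \<Delta>"
      unfolding S_def by blast
    define h where "h = (\<lambda>w. T1 (g w))"
    have \<Delta>: "open \<Delta>" and hol: "right_holomorphic_on g \<Delta>"
      and hol2: "right_holomorphic_on (on_section \<Phi> g) \<Delta>"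
      using g(3) \<Psi>sec[OF g(3)] by (auto simp: eigensection_def)
    have "eigensection T1 B \<Delta> h"
      using g(3) right_holomorphic_L_r[OF L1 hol]
      by (auto simp: eigensection_def h_def eigenspace_def L_r_simps(6)[OF L1])
    moreover have "(right_deriv ^^ m) h z0 = T1 a"
      unfolding h_def g(1) by (rule higher_right_deriv_L_r[OF L1 hol \<Delta> g(4)])
    moreover have "(right_deriv ^^ m) (on_section \<Phi> h) z0 = T2 b"
    proof -
      have "on_section \<Phi> h w = T2 (on_section \<Phi> g w)" if w: "w \<in> \<Delta>" for w
      proof -
        have wB: "w \<in> B" and gw: "g w \<in> eigenspace T1 w"
          using g(3) w by (auto simp: eigensection_def)
        have "on_section \<Phi> h w = ?\<Psi> w (g w *\<^sub>Q quat_of_complex w)"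
          using gw by (simp add: on_section_def h_def eigenspace_def)
        also have "\<dots> = ?\<Psi> w (g w) *\<^sub>Q quat_of_complex w"
          using iso[OF wB] eigenspace_subset_op_ker[OF L1 gw] by (simp add: right_linear_iso_def fib[OF wB])
        also have "\<dots> = T2 (on_section \<Phi> g w)"
          using \<Psi>sec[OF g(3)] w by (auto simp: eigensection_def eigenspace_def on_section_def)
        finally show ?thesis .
      qed
      from higher_right_deriv_cong[OF \<Delta> this g(4)] show ?thesis
        using higher_right_deriv_L_r[OF L2 hol2 \<Delta> g(4), of m] g(2) by simp
    qed
    ultimately show "(T1 a, T2 b) \<in> S"
      unfolding S_def using g(4) by (intro CollectI exI[of _ m] exI[of _ h]) auto
  qed
qed

theorem theorem4p4:
  fixes n :: nat
    and \<Omega> :: "quat set"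
    and T1 T2 :: "'a::separable_quat_hilbert \<Rightarrow> 'a"
  assumes "n > 0"
    and "axially_symmetric \<Omega>" and "connected \<Omega>" and "open \<Omega>"
    and "\<Omega> \<inter> \<real> = {}"
    and "T1 \<in> B_s n \<Omega>" and "T2 \<in> B_s n \<Omega>"
  shows "q_unitarily_equivalent T1 T2 \<longleftrightarrow>
    hermitian_bundles_equivalent (qred ` \<Omega>) (E_bundle \<Omega> T1) (E_bundle \<Omega> T2)"
proof
  assume "q_unitarily_equivalent T1 T2"
  then show "hermitian_bundles_equivalent (qred ` \<Omega>) (E_bundle \<Omega> T1) (E_bundle \<Omega> T2)"
    by (rule unitarily_equivalent_imp_bundles_equivalent[OF B_sD(1)[OF assms(6)] B_sD(1)[OF assms(7)]])
next
  assume eq: "hermitian_bundles_equivalent (qred ` \<Omega>) (E_bundle \<Omega> T1) (E_bundle \<Omega> T2)"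
  show "q_unitarily_equivalent T1 T2"
  proof (cases "\<Omega> = {}")
    case True
    \<comment> \<open>Density of the empty family of kernels forces the Hilbert space to be zero.\<close>
    then have "UNIV = {0 :: 'a}"
      using B_sD(3)[OF assms(6)] by (simp add: qspan_def)
    then have "x = y" for x y :: 'a by (metis UNIV_I singletonD)
    then have "T1 = id" "T2 = id" by (auto simp: fun_eq_iff)
    moreover have "id \<in> L_r" by (simp add: L_r_def bounded_linear_ident id_def)
    ultimately show ?thesis
      unfolding q_unitarily_equivalent_def is_qadjoint_def by (intro bexI[of _ id] conjI) auto
  next
    case False
    then show ?thesis
      using bundles_equivalent_imp_unitarily_equivalent assms(2-7) eq by blast
  qed
qed

end
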